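(* Let $W$ be a Weyl tensor of type IM$^-$ with $M\neq-6$, with eigenvalues $\rho_1,\rho_2,\rho_3$ labelled so that $|\rho_1|=|\rho_2|$, and orthonormal frame $\{\mathcal U_i\}$ of self-dual eigenbivectors, so that $\mathcal W=-\sum_{i}\rho_i\,\mathcal U_i\otimes\mathcal U_i$. Put $t=|\rho_1|^2=|\rho_2|^2$, $t_3=|\rho_3|^2$, $\tau=\rho_2\overline\rho_3=\rho_3\overline\rho_1$, $\tau_3=\rho_1\overline\rho_2$, $\Pi_i=\mathcal U_i\cdot\overline{\mathcal U}_i$, $\Pi_{jk}=\mathcal U_j\cdot\overline{\mathcal U}_k$. Then the Bel-Robinson tensor $T$ of $W$ admits the canonical expression $$\begin{aligned}T={}&t(\Pi_1\otimes\Pi_1+\Pi_2\otimes\Pi_2)+t_3\Pi_3\otimes\Pi_3+\tau(\Pi_{23}\otimes\Pi_{23}+\Pi_{31}\otimes\Pi_{31})\\&+\overline\tau(\Pi_{32}\otimes\Pi_{32}+\Pi_{13}\otimes\Pi_{13})+\tau_3\Pi_{12}\otimes\Pi_{12}+\overline\tau_3\Pi_{21}\otimes\Pi_{21}.\end{aligned}$$ The eigenvalues $t_3,\tau_3,\overline\tau_3$ are simple and are associated with the eigentensors $\Pi_3,\Pi_{12},\Pi_{21}$, respectively. The eigenvalues $t,\tau,\overline\tau$ are double and are associated, respectively, with the eigenplanes $S_t=\langle\Pi_1,\Pi_2\rangle$, $S_\tau=\langle\Pi_{23},\Pi_{31}\rangle$ and $S_{\overline\tau}=\langle\Pi_{3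2},\Pi_{13}\rangle$.
   Context: $(V,g)$ is an oriented 4-dimensional real vector space with a Lorentzian metric of signature $(-,+,+,+)$ (the tangent space of a space-time at a point); indices are moved with $g$; $\eta$ is the metric volume element; $( *F)_{\alpha\beta}=\frac12\eta_{\alpha\beta\mu\nu}F^{\mu\nu}$, $( *W)_{\alpha\beta\mu\nu}=\frac12\eta_{\alpha\beta}{}^{\rho\sigma}W_{\rho\sigma\mu\nu}$. A self-dual (SD) bivector is a complex 2-form $\mathcal F$ with $*\mathcal F=\mathrm i\mathcal F$; these form a complex 3-dimensional space with metric $\mathcal G(\mathcal F,\mathcal H)=\frac12\mathcal F_{\alpha\beta}\mathcal H^{\alpha\beta}$. A frame $\{\mathcal U_i\}$ of SD bivectors is orthonormal if $\mathcal G(\mathcal U_i,\mathcal U_j)=-\delta_{ij}$. A Weyl tensor $W$ is a real 4-tensor with the algebraic symmetries of a Riemann tensor and vanishing traces; $\mathcal W=\frac12(W-\mathrm i*W)$ acts on SD bivectors by $\mathcal W(\mathcal F)_{\alpha\beta}=\frac12\mathcal W_{\alpha\beta}{}^{\mu\nu}\mathcal F_{\mu\nu}$, with eigenvalues $\rho_i$, $\sum\rho_i=0$. Put $a=\operatorname{Tr}\mathcal W^2=\sum\rho_i^2$, $b=\operatorname{Tr}\mathcal W^3=\sum\rho_i^3$, $M=a^3/b^2-6$. $W$ is of type I if the $\rho_i$ are distinct (equivalently $6b^2\neq a^3$), and of type IM$^-$ if it is of type I, $b\neq0$ and $M$ is a negative real number; in this case two eigenvalues have equal modulus. The Bel-Robinson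 (BR) tensor of $W$ is $T_{\alpha\mu\beta\nu}=\mathcal W_{\alpha}{}^{\rho}{}_{\beta}{}^{\sigma}\,\overline{\mathcal W}_{\mu\rho\nu\sigma}$; it is totally symmetric and traceless and acts on the (complexified) 9-dimensional space of traceless symmetric 2-tensors by $T(A)_{\alpha\beta}=T_{\alpha\beta}{}^{\mu\nu}A_{\mu\nu}$; an eigentensor is an eigenvector of this map. For 2-tensors $(A\cdot B)_{\alpha\beta}=A_{\alpha}{}^{\mu}B_{\mu\beta}$. $\langle\cdot\rangle$ denotes (complex) linear span. *)

theory Defs
  imports "HOL-Analysis.Analysis"
begin

text \<open>
  The space \<open>V\<close> is \<open>real^4\<close>, i.e. all tensors are covariant and are given by their components in an
  arbitrary basis, the indices running over the type \<open>4\<close> with elements \<open>0, 1, 2, 3\<close>. The metric is an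
  arbitrary Lorentzian \<open>g\<close>, and the orientation is the sign \<open>s\<close> that it gives to the basis, so no
  convention on the sign of \<open>\<eta>\<^bsub>0123\<^esub>\<close> is fixed.
\<close>

type_synonym tensor2 = "complex^4^4"
type_synonym tensor4 = "complex^4^4^4^4"

definition lorentzian :: "real^4^4 \<Rightarrow> bool" where
  "lorentzian g \<longleftrightarrow>
     (\<exists>Q :: real^4^4. invertible Q \<and>
          transpose Q ** g ** Q = (\<chi> a b. if a = b then (if a = 0 then -1 else 1) else 0))"

definition ginv :: "real^4^4 \<Rightarrow> complex^4^4" where
  "ginv g = (\<chi> a b. complex_of_real (matrix_inv g $ a $ b))"

definition raise2 :: "real^4^4 \<Rightarrow> tensor2 \<Rightarrow> tensor2" where
  "raise2 g F = (\<chi> a b. \<Sum>c\<in>UNIV. \<Sum>d\<in>UNIV. ginv g $ a $ c * ginv g $ b $ d * F $ c $ d)"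

text \<open>The determinant below is the Levi-Civita symbol, equal to \<open>1\<close> for \<open>(a, b, c, d) = (0, 1, 2, 3)\<close>.\<close>

definition volume_element :: "real \<Rightarrow> real^4^4 \<Rightarrow> 4 \<Rightarrow> 4 \<Rightarrow> 4 \<Rightarrow> 4 \<Rightarrow> real" where
  "volume_element s g a b c d =
     s * sqrt \<bar>det g\<bar> *
     det (\<chi> i. axis (if i = 0 then a else if i = 1 then b else if i = 2 then c else d) 1 :: real^4^4)"

definition hodge2 :: "real \<Rightarrow> real^4^4 \<Rightarrow> tensor2 \<Rightarrow> tensor2" where
  "hodge2 s g F =
     (\<chi> a b. 1/2 * (\<Sum>m\<in>UNIV. \<Sum>n\<in>UNIV. complex_of_real (volume_element s g a b m n) * raise2 g F $ m $ n))"

definition hodge4 :: "real \<Rightarrow> real^4^4 \<Rightarrow> tensor4 \<Rightarrow> tensor4" where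
  "hodge4 s g X = (\<chi> a b m n. hodge2 s g (\<chi> r q. X $ r $ q $ m $ n) $ a $ b)"

definition self_dual :: "real \<Rightarrow> real^4^4 \<Rightarrow> tensor2 \<Rightarrow> bool" where
  "self_dual s g F \<longleftrightarrow> (\<forall>a b. F $ a $ b = - F $ b $ a) \<and> hodge2 s g F = (\<chi> a b. \<i> * F $ a $ b)"

definition bivector_metric :: "real^4^4 \<Rightarrow> tensor2 \<Rightarrow> tensor2 \<Rightarrow> complex" where
  "bivector_metric g F H = 1/2 * (\<Sum>a\<in>UNIV. \<Sum>b\<in>UNIV. F $ a $ b * raise2 g H $ a $ b)"

definition weyl_tensor :: "real^4^4 \<Rightarrow> real^4^4^4^4 \<Rightarrow> bool" where
  "weyl_tensor g W \<longleftrightarrow>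
     (\<forall>a b c d. W $ a $ b $ c $ d = - W $ b $ a $ c $ d) \<and>
     (\<forall>a b c d. W $ a $ b $ c $ d = - W $ a $ b $ d $ c) \<and>
     (\<forall>a b c d. W $ a $ b $ c $ d = W $ c $ d $ a $ b) \<and>
     (\<forall>a b c d. W $ a $ b $ c $ d + W $ a $ c $ d $ b + W $ a $ d $ b $ c = 0) \<and>
     (\<forall>b d. (\<Sum>a\<in>UNIV. \<Sum>c\<in>UNIV. matrix_inv g $ a $ c * W $ a $ b $ c $ d) = 0)"

definition sd_weyl :: "real \<Rightarrow> real^4^4 \<Rightarrow> real^4^4^4^4 \<Rightarrow> tensor4" where
  "sd_weyl s g W =
     (let Wc = (\<chi> a b c d. complex_of_real (W $ a $ b $ c $ d))
      in \<chi> a b c d. 1/2 * (Wc $ a $ b $ c $ d - \<i> * hodge4 s g Wc $ a $ b $ c $ d))"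

text \<open>
  A 4-tensor acts on bivectors with a factor \<open>1/2\<close>, each pair of antisymmetric indices being counted
  twice; the same factor appears in the composition and in the trace. As \<open>sd_weyl s g W\<close> vanishes on
  anti-self-dual bivectors, its trace on all bivectors is its trace on the self-dual ones.
\<close>

definition bivector_action :: "real^4^4 \<Rightarrow> tensor4 \<Rightarrow> tensor2 \<Rightarrow> tensor2" where
  "bivector_action g X F =
     (\<chi> a b. 1/2 * (\<Sum>m\<in>UNIV. \<Sum>n\<in>UNIV. X $ a $ b $ m $ n * raise2 g F $ m $ n))"

definition bivector_comp :: "real^4^4 \<Rightarrow> tensor4 \<Rightarrow> tensor4 \<Rightarrow> tensor4" where
  "bivector_comp g X Y = (\<chi> a b m n. bivector_action g X (\<chi> r q. Y $ r $ q $ m $ n) $ a $ b)"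

definition bivector_trace :: "real^4^4 \<Rightarrow> tensor4 \<Rightarrow> complex" where
  "bivector_trace g X = 1/2 * (\<Sum>a\<in>UNIV. \<Sum>b\<in>UNIV. raise2 g (\<chi> m n. X $ a $ b $ m $ n) $ a $ b)"

definition weyl_a :: "real \<Rightarrow> real^4^4 \<Rightarrow> real^4^4^4^4 \<Rightarrow> complex" where
  "weyl_a s g W = (let w = sd_weyl s g W in bivector_trace g (bivector_comp g w w))"

definition weyl_b :: "real \<Rightarrow> real^4^4 \<Rightarrow> real^4^4^4^4 \<Rightarrow> complex" where
  "weyl_b s g W =
     (let w = sd_weyl s g W in bivector_trace g (bivector_comp g w (bivector_comp g w w)))"

definition weyl_M :: "real \<Rightarrow> real^4^4 \<Rightarrow> real^4^4^4^4 \<Rightarrow> complex" where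
  "weyl_M s g W = weyl_a s g W ^ 3 / weyl_b s g W ^ 2 - 6"

definition weyl_eigenvalues :: "real \<Rightarrow> real^4^4 \<Rightarrow> real^4^4^4^4 \<Rightarrow> complex set" where
  "weyl_eigenvalues s g W =
     {r. \<exists>F. self_dual s g F \<and> F \<noteq> 0 \<and>
             bivector_action g (sd_weyl s g W) F = (\<chi> a b. r * F $ a $ b)}"

text \<open>The self-dual bivectors have dimension 3, so all eigenvalues are distinct iff there are 3 of them.\<close>

definition type_I :: "real \<Rightarrow> real^4^4 \<Rightarrow> real^4^4^4^4 \<Rightarrow> bool" where
  "type_I s g W \<longleftrightarrow> card (weyl_eigenvalues s g W) = 3"

definition type_IM_minus :: "real \<Rightarrow> real^4^4 \<Rightarrow> real^4^4^4^4 \<Rightarrow> bool" where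
  "type_IM_minus s g W \<longleftrightarrow>
     type_I s g W \<and> weyl_b s g W \<noteq> 0 \<and> weyl_M s g W \<in> \<real> \<and> Re (weyl_M s g W) < 0"

definition bel_robinson :: "real \<Rightarrow> real^4^4 \<Rightarrow> real^4^4^4^4 \<Rightarrow> tensor4" where
  "bel_robinson s g W =
     (let w = sd_weyl s g W
      in \<chi> a m b n. \<Sum>r\<in>UNIV. \<Sum>q\<in>UNIV.
           raise2 g (\<chi> r' q'. w $ a $ r' $ b $ q') $ r $ q * cnj (w $ m $ r $ n $ q))"

definition tensor_dot :: "real^4^4 \<Rightarrow> tensor2 \<Rightarrow> tensor2 \<Rightarrow> tensor2" where
  "tensor_dot g A B = A ** ginv g ** B"

definition cnj2 :: "tensor2 \<Rightarrow> tensor2" where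
  "cnj2 F = (\<chi> a b. cnj (F $ a $ b))"

definition tensor_prod :: "tensor2 \<Rightarrow> tensor2 \<Rightarrow> tensor4"  (infixr "\<otimes>" 75) where
  "A \<otimes> B = (\<chi> a b c d. A $ a $ b * B $ c $ d)"

definition scale2 :: "complex \<Rightarrow> tensor2 \<Rightarrow> tensor2"  (infixr "*\<^sub>2" 70) where
  "c *\<^sub>2 A = (\<chi> a b. c * A $ a $ b)"

definition scale4 :: "complex \<Rightarrow> tensor4 \<Rightarrow> tensor4"  (infixr "*\<^sub>4" 70) where
  "c *\<^sub>4 X = (\<chi> a b m n. c * X $ a $ b $ m $ n)"

text \<open>
  Complex span and dimension are \<open>ctensor.span\<close> and \<open>ctensor.dim\<close>; the unqualified \<open>span\<close> and \<open>dim\<close>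
  are the ones over the reals.
\<close>

global_interpretation ctensor: vector_space scale2
  by standard (simp_all add: scale2_def vec_eq_iff algebra_simps)

definition traceless_symmetric :: "real^4^4 \<Rightarrow> tensor2 set" where
  "traceless_symmetric g =
     {A. (\<forall>a b. A $ a $ b = A $ b $ a) \<and> (\<Sum>a\<in>UNIV. \<Sum>b\<in>UNIV. ginv g $ a $ b * A $ a $ b) = 0}"

definition tensor_action :: "real^4^4 \<Rightarrow> tensor4 \<Rightarrow> tensor2 \<Rightarrow> tensor2" where
  "tensor_action g T A = (\<chi> a b. \<Sum>m\<in>UNIV. \<Sum>n\<in>UNIV. T $ a $ b $ m $ n * raise2 g A $ m $ n)"

definition eigenspace :: "real^4^4 \<Rightarrow> tensor4 \<Rightarrow> complex \<Rightarrow> tensor2 set" where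
  "eigenspace g T r = {A \<in> traceless_symmetric g. tensor_action g T A = r *\<^sub>2 A}"

text \<open>Algebraic multiplicity, as the dimension of the generalised eigenspace.\<close>

definition eigenvalue_multiplicity :: "real^4^4 \<Rightarrow> tensor4 \<Rightarrow> complex \<Rightarrow> nat" where
  "eigenvalue_multiplicity g T r =
     ctensor.dim {A \<in> traceless_symmetric g. \<exists>k. ((\<lambda>X. tensor_action g T X - r *\<^sub>2 X) ^^ k) A = 0}"

end

theory Submission
  imports Defs
begin

text \<open>
  In an oriented orthonormal tetrad the self-dual bivectors, the products
  \<open>\<Pi>\<^sub>i\<^sub>j\<close>, and the Weyl symmetries are explicit, and all statements
  needed are finite component computations there. They say that self-dual and anti-self-dual
  bivectors together span all bivectors, that the nine products form an orthonormal basis of the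
  traceless symmetric tensors, and that a Weyl tensor, as a quadratic form on bivectors, has no mixed
  block and a traceless self-dual block. These facts are invariant under complex rotations of the
  frame, so they hold for every orthonormal self-dual frame. Expanding the Weyl tensor and
  the Bel-Robinson tensor in an eigenframe gives \<open>T = \<Sum>\<^sub>i\<^sub>j \<rho>\<^sub>i cnj \<rho>\<^sub>j \<Pi>\<^sub>i\<^sub>j \<otimes> \<Pi>\<^sub>i\<^sub>j\<close>, which is diagonal in
  the basis \<open>\<Pi>\<^sub>i\<^sub>j\<close>; with \<open>\<rho>\<^sub>3 = - \<rho>\<^sub>1 - \<rho>\<^sub>2\<close> and \<open>\<bar>\<rho>\<^sub>1\<bar> = \<bar>\<rho>\<^sub>2\<bar>\<close>, a coincidence among the six listed
  eigenvalues would force \<open>\<rho>\<^sub>1 = \<rho>\<^sub>2\<close>, \<open>b = 0\<close> or \<open>a = 0\<close>, that is \<open>M = -6\<close>.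
\<close>

section \<open>The Levi-Civita symbol\<close>

text \<open>The eigenframe is complex, and fitting a real tetrad to it would require the isomorphism
  between SO(3,C) and the restricted Lorentz group. Instead a reference frame is read off from any
  oriented tetrad, and the given frame is compared with it through a 3 by 3 matrix. This works
  because all metrics on complex tensors here are bilinear, not Hermitian: the matrix is orthogonal
  rather than unitary, and \<open>T\<close> becomes diagonal with the same \<open>P i j\<close> in
  both tensor slots. A basis that diagonalises \<open>T\<close> also settles the algebraic
  multiplicities, since no nilpotent part can occur. The norm -1 of the frame bivectors causes the
  minus signs in all bivector expansions; a product \<open>P i j\<close> combines two such signs and
  has norm 1.\<close>

lemma UNIV_4_0: "(UNIV :: 4 set) = {0, 1, 2, 3}"
proof -
  have "(4 :: 4) = 0" by simp
  then have "(UNIV :: 4 set) = {1, 2, 3, 0}" using UNIV_4 by metis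
  then show ?thesis by blast
qed

lemma sum_4_0: "sum f (UNIV :: 4 set) = f 0 + f 1 + f 2 + f 3"
  unfolding UNIV_4_0 by (simp add: add.assoc)

lemma prod_4_0: "prod f (UNIV :: 4 set) = f 0 * f 1 * f 2 * f 3"
  unfolding UNIV_4_0 by (simp add: mult.assoc)

lemma forall_4_0: "(\<forall>i::4. P i) \<longleftrightarrow> P 0 \<and> P 1 \<and> P 2 \<and> P 3"
proof -
  have "(\<forall>i::4. P i) \<longleftrightarrow> (\<forall>i\<in>{0, 1, 2, 3}. P i)"
    unfolding UNIV_4_0[symmetric] by simp
  then show ?thesis by simp
qed

definition levi_civita :: "4 \<Rightarrow> 4 \<Rightarrow> 4 \<Rightarrow> 4 \<Rightarrow> real" where
  "levi_civita a b c d =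
     det (\<chi> i. axis (if i = 0 then a else if i = 1 then b else if i = 2 then c else d) 1 :: real^4^4)"

lemma det_transpose_rows:
  assumes "j \<noteq> k"
  shows "det (\<chi> i. A $ (Transposition.transpose j k i) :: real^4^4) = - det A"
  using det_permute_rows[of "Transposition.transpose j k" A] assms
  by (simp add: permutes_swap_id sign_swap_id)

lemma levi_civita_swap:
  shows "levi_civita b a c d = - levi_civita a b c d"
    and "levi_civita a c b d = - levi_civita a b c d"
    and "levi_civita a b d c = - levi_civita a b c d"
proof -
  let ?A = "(\<chi> i. axis (if i = 0 then a else if i = 1 then b else if i = 2 then c else d) 1) :: real^4^4"
  have "(\<lambda>i. axis (if i = 0 then b else if i = 1 then a else if i = 2 then c else d) 1 :: real^4) = (\<lambda>i. ?A $ Transposition.transpose 0 1 i)"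
    unfolding fun_eq_iff forall_4_0 by (simp add: Transposition.transpose_def)
  then show "levi_civita b a c d = - levi_civita a b c d"
    using det_transpose_rows[of 0 1 ?A] by (simp add: levi_civita_def)
  have "(\<lambda>i. axis (if i = 0 then a else if i = 1 then c else if i = 2 then b else d) 1 :: real^4) = (\<lambda>i. ?A $ Transposition.transpose 1 2 i)"
    unfolding fun_eq_iff forall_4_0 by (simp add: Transposition.transpose_def)
  then show "levi_civita a c b d = - levi_civita a b c d"
    using det_transpose_rows[of 1 2 ?A] by (simp add: levi_civita_def)
  have "(\<lambda>i. axis (if i = 0 then a else if i = 1 then b else if i = 2 then d else c) 1 :: real^4) = (\<lambda>i. ?A $ Transposition.transpose 2 3 i)"
    unfolding fun_eq_iff forall_4_0 by (simp add: Transposition.transpose_def)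
  then show "levi_civita a b d c = - levi_civita a b c d"
    using det_transpose_rows[of 2 3 ?A] by (simp add: levi_civita_def)
qed

lemma levi_civita_repeated:
  "levi_civita a a c d = 0" "levi_civita a b a d = 0" "levi_civita a b c a = 0"
  "levi_civita a b b d = 0" "levi_civita a b c b = 0" "levi_civita a b c c = 0"
proof -
  show 1: "levi_civita a a c d = 0" for a c d using levi_civita_swap(1)[of a a c d] by simp
  show 2: "levi_civita a b b d = 0" for a b d using levi_civita_swap(2)[of a b b d] by simp
  show 3: "levi_civita a b c c = 0" for a b c using levi_civita_swap(3)[of a b c c] by simp
  show 4: "levi_civita a b a d = 0" for a b d using levi_civita_swap(2)[of a b a d] 1 by simp
  show "levi_civita a b c b = 0" for a b c using levi_civita_swap(3)[of a b c b] 2 by simp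
  show "levi_civita a b c a = 0" for a b c using levi_civita_swap(3)[of a b c a] 4 by simp
qed

lemma levi_civita_0123: "levi_civita 0 1 2 3 = 1"
proof -
  have "(\<chi> i. axis (if i = 0 then 0 else if i = 1 then 1 else if i = 2 then 2 else 3) 1) = (mat 1 :: real^4^4)"
    by (simp add: vec_eq_iff forall_4_0 axis_def mat_def)
  then show ?thesis by (simp add: levi_civita_def)
qed

text \<open>Each value comes from an earlier one by a single adjacent swap, starting from
  \<open>levi_civita_0123\<close>; the determinant is never expanded.\<close>

lemma levi_civita_values:
  "levi_civita 0 1 2 3 = 1" "levi_civita 0 1 3 2 = -1" "levi_civita 0 2 1 3 = -1"
  "levi_civita 0 2 3 1 = 1" "levi_civita 0 3 1 2 = 1" "levi_civita 0 3 2 1 = -1"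
  "levi_civita 1 0 2 3 = -1" "levi_civita 1 0 3 2 = 1" "levi_civita 1 2 0 3 = 1"
  "levi_civita 1 2 3 0 = -1" "levi_civita 1 3 0 2 = -1" "levi_civita 1 3 2 0 = 1"
  "levi_civita 2 0 1 3 = 1" "levi_civita 2 0 3 1 = -1" "levi_civita 2 1 0 3 = -1"
  "levi_civita 2 1 3 0 = 1" "levi_civita 2 3 0 1 = 1" "levi_civita 2 3 1 0 = -1"
  "levi_civita 3 0 1 2 = -1" "levi_civita 3 0 2 1 = 1" "levi_civita 3 1 0 2 = 1"
  "levi_civita 3 1 2 0 = -1" "levi_civita 3 2 0 1 = -1" "levi_civita 3 2 1 0 = 1"
proof -
  note v = levi_civita_0123
  note s1 = levi_civita_swap(1) note s2 = levi_civita_swap(2) note s3 = levi_civita_swap(3)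
  show "levi_civita 0 1 2 3 = 1" by (rule v)
  show a1: "levi_civita 0 1 3 2 = -1" using v s3[of 0 1 3 2] by simp
  show a2: "levi_civita 0 2 1 3 = -1" using v s2[of 0 2 1 3] by simp
  show a3: "levi_civita 0 2 3 1 = 1" using a2 s3[of 0 2 3 1] by simp
  show a4: "levi_civita 0 3 1 2 = 1" using a1 s2[of 0 3 1 2] by simp
  show a5: "levi_civita 0 3 2 1 = -1" using a4 s3[of 0 3 2 1] by simp
  show b0: "levi_civita 1 0 2 3 = -1" using v s1[of 1 0 2 3] by simp
  show b1: "levi_civita 1 0 3 2 = 1" using a1 s1[of 1 0 3 2] by simp
  show c0: "levi_civita 2 0 1 3 = 1" using a2 s1[of 2 0 1 3] by simp
  show c1: "levi_civita 2 0 3 1 = -1" using a3 s1[of 2 0 3 1] by simp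
  show d0: "levi_civita 3 0 1 2 = -1" using a4 s1[of 3 0 1 2] by simp
  show d1: "levi_civita 3 0 2 1 = 1" using a5 s1[of 3 0 2 1] by simp
  show b2: "levi_civita 1 2 0 3 = 1" using b0 s2[of 1 2 0 3] by simp
  show b3: "levi_civita 1 2 3 0 = -1" using b2 s3[of 1 2 3 0] by simp
  show b4: "levi_civita 1 3 0 2 = -1" using b1 s2[of 1 3 0 2] by simp
  show b5: "levi_civita 1 3 2 0 = 1" using b4 s3[of 1 3 2 0] by simp
  show c2: "levi_civita 2 1 0 3 = -1" using c0 s2[of 2 1 0 3] by simp
  show c3: "levi_civita 2 1 3 0 = 1" using c2 s3[of 2 1 3 0] by simp
  show c4: "levi_civita 2 3 0 1 = 1" using c1 s2[of 2 3 0 1] by simp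
  show c5: "levi_civita 2 3 1 0 = -1" using c4 s3[of 2 3 1 0] by simp
  show d2: "levi_civita 3 1 0 2 = 1" using d0 s2[of 3 1 0 2] by simp
  show d3: "levi_civita 3 1 2 0 = -1" using d2 s3[of 3 1 2 0] by simp
  show d4: "levi_civita 3 2 0 1 = -1" using d1 s2[of 3 2 0 1] by simp
  show d5: "levi_civita 3 2 1 0 = 1" using d4 s3[of 3 2 1 0] by simp
qed

lemma volume_element_levi_civita:
  "volume_element s g a b c d = s * sqrt \<bar>det g\<bar> * levi_civita a b c d"
  by (simp add: volume_element_def levi_civita_def)

text \<open>Multiplying the matrix of unit rows by \<open>transpose Q\<close> turns each row into a
  column of \<open>Q\<close>. Multilinearity in the rows then gives a sum over all maps from indices
  to indices, and such a map is the quadruple of its values.\<close>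

lemma levi_civita_covariant:
  fixes Q :: "real^4^4"
  shows "(\<Sum>a\<in>UNIV. \<Sum>b\<in>UNIV. \<Sum>c\<in>UNIV. \<Sum>d\<in>UNIV.
            Q $ a $ a' * Q $ b $ b' * Q $ c $ c' * Q $ d $ d' * levi_civita a b c d) =
         det Q * levi_civita a' b' c' d'"
proof -
  define ix where "ix a b c d = (\<lambda>i::4. if i = 0 then a else if i = 1 then b else if i = 2 then c else d)"
    for a b c d :: 4
  let ?v = "\<lambda>f. (\<chi> i. axis (f i) 1) :: real^4^4"
  have lc: "levi_civita a b c d = det (?v (ix a b c d))" for a b c d
    by (simp add: levi_civita_def ix_def)
  have "det Q * levi_civita a' b' c' d' = det (?v (ix a' b' c' d') ** transpose Q)"
    by (simp add: lc det_mul)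
  also have "?v (ix a' b' c' d') ** transpose Q =
      (\<chi> i. \<Sum>j\<in>UNIV. Q $ j $ ix a' b' c' d' i *s axis j 1)"
    by (simp add: vec_eq_iff matrix_matrix_mult_def transpose_def axis_def if_distrib if_distribR
        sum.delta' cong: if_cong)
  also have "det \<dots> = (\<Sum>f | \<forall>i. f i \<in> (UNIV :: 4 set). det (\<chi> i. Q $ f i $ ix a' b' c' d' i *s axis (f i) 1))"
    by (rule det_linear_rows_sum) simp
  also have "\<dots> = (\<Sum>f\<in>UNIV. (\<Prod>i\<in>UNIV. Q $ f i $ ix a' b' c' d' i) * det (?v f))"
    by (simp add: det_rows_mul)
  also have "\<dots> = (\<Sum>(a, b, c, d)\<in>UNIV \<times> UNIV \<times> UNIV \<times> UNIV.
            Q $ a $ a' * Q $ b $ b' * Q $ c $ c' * Q $ d $ d' * levi_civita a b c d)"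
  proof (rule sum.reindex_bij_witness[of _ "\<lambda>(a, b, c, d). ix a b c d" "\<lambda>f. (f 0, f 1, f 2, f 3)"])
    fix f :: "4 \<Rightarrow> 4"
    have f: "ix (f 0) (f 1) (f 2) (f 3) = f"
      unfolding fun_eq_iff forall_4_0 by (simp add: ix_def)
    then show "(case (f 0, f 1, f 2, f 3) of (a, b, c, d) \<Rightarrow> ix a b c d) = f"
      by simp
    show "(case (f 0, f 1, f 2, f 3) of (a, b, c, d) \<Rightarrow>
        Q $ a $ a' * Q $ b $ b' * Q $ c $ c' * Q $ d $ d' * levi_civita a b c d) =
      (\<Prod>i\<in>UNIV. Q $ f i $ ix a' b' c' d' i) * det (?v f)"
    proof -
      have "levi_civita (f 0) (f 1) (f 2) (f 3) = det (?v f)"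
        by (simp only: lc f)
      then show ?thesis
        by (simp add: prod_4_0 ix_def)
    qed
  qed (auto simp: ix_def)
  finally show ?thesis
    by (simp add: sum.cartesian_product)
qed

section \<open>Self-dual bivectors in Minkowski space\<close>

definition minkowski :: "real^4^4" where
  "minkowski = (\<chi> a b. if a = b then (if a = 0 then -1 else 1) else 0)"

definition pairing :: "real^4^4 \<Rightarrow> tensor2 \<Rightarrow> tensor2 \<Rightarrow> complex" where
  "pairing g F H = (\<Sum>a\<in>UNIV. \<Sum>b\<in>UNIV. F $ a $ b * raise2 g H $ a $ b)"

text \<open>The full contraction counts each antisymmetric pair twice and omits the two factors 1/2,
  hence the factor 1/4 in \<open>weyl_form_action\<close>.\<close>

definition weyl_form :: "real^4^4 \<Rightarrow> real^4^4^4^4 \<Rightarrow> tensor2 \<Rightarrow> tensor2 \<Rightarrow> complex" where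
  "weyl_form g W F H = (\<Sum>a\<in>UNIV. \<Sum>b\<in>UNIV. \<Sum>m\<in>UNIV. \<Sum>n\<in>UNIV.
     complex_of_real (W $ a $ b $ m $ n) * raise2 g F $ a $ b * raise2 g H $ m $ n)"

lemma minkowski_square: "minkowski ** minkowski = mat 1"
  by (simp add: vec_eq_iff forall_4_0 sum_4_0 matrix_matrix_mult_def minkowski_def mat_def)

lemma matrix_inv_unique_left:
  fixes A B :: "'a::field^'n^'n"
  assumes "A ** B = mat 1"
  shows "matrix_inv A = B"
proof -
  have "B ** A = mat 1"
    using assms matrix_left_right_inverse by blast
  then have "matrix_inv A ** A = mat 1"
    unfolding matrix_inv_def using assms by (rule_tac someI2[of _ B]) auto
  then have "(matrix_inv A ** A) ** B = B"
    by simp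
  then show ?thesis
    by (simp add: assms flip: matrix_mul_assoc)
qed

lemma matrix_inv_minkowski: "matrix_inv minkowski = minkowski"
  by (rule matrix_inv_unique_left[OF minkowski_square])

lemma det_minkowski: "det minkowski = -1"
  by (subst det_diagonal) (auto simp: minkowski_def prod_4_0)

lemma ginv_minkowski: "ginv minkowski $ a $ b = (if a = b then (if a = 0 then -1 else 1) else 0)"
  by (simp add: ginv_def matrix_inv_minkowski) (simp add: minkowski_def)

lemma raise2_minkowski:
  "raise2 minkowski F $ a $ b = (if a = 0 then -1 else 1) * (if b = 0 then -1 else 1) * F $ a $ b"
proof -
  have "raise2 minkowski F $ a $ b = (\<Sum>c\<in>UNIV. \<Sum>d\<in>UNIV.
      if d = b then (if c = a then (if a = 0 then -1 else 1) * (if b = 0 then -1 else 1) * F $ a $ b else 0) else 0)"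
    unfolding raise2_def vec_lambda_beta
    by (rule sum.cong[OF refl], rule sum.cong[OF refl]) (auto simp: ginv_minkowski)
  also have "\<dots> = (if a = 0 then -1 else 1) * (if b = 0 then -1 else 1) * F $ a $ b"
    by simp
  finally show ?thesis .
qed

text \<open>\<open>F\<close> is arbitrary, and only its antisymmetric part contributes, whence the
  halved differences. The components 23, 31, 12 carry the sign from raising an index 0.\<close>

lemma hodge2_minkowski:
  "hodge2 1 minkowski F $ 0 $ 0 = 0" "hodge2 1 minkowski F $ 1 $ 1 = 0"
  "hodge2 1 minkowski F $ 2 $ 2 = 0" "hodge2 1 minkowski F $ 3 $ 3 = 0"
  "hodge2 1 minkowski F $ 0 $ 1 = (F $ 2 $ 3 - F $ 3 $ 2) / 2"
  "hodge2 1 minkowski F $ 1 $ 0 = (F $ 3 $ 2 - F $ 2 $ 3) / 2"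
  "hodge2 1 minkowski F $ 0 $ 2 = (F $ 3 $ 1 - F $ 1 $ 3) / 2"
  "hodge2 1 minkowski F $ 2 $ 0 = (F $ 1 $ 3 - F $ 3 $ 1) / 2"
  "hodge2 1 minkowski F $ 0 $ 3 = (F $ 1 $ 2 - F $ 2 $ 1) / 2"
  "hodge2 1 minkowski F $ 3 $ 0 = (F $ 2 $ 1 - F $ 1 $ 2) / 2"
  "hodge2 1 minkowski F $ 2 $ 3 = (F $ 1 $ 0 - F $ 0 $ 1) / 2"
  "hodge2 1 minkowski F $ 3 $ 2 = (F $ 0 $ 1 - F $ 1 $ 0) / 2"
  "hodge2 1 minkowski F $ 3 $ 1 = (F $ 2 $ 0 - F $ 0 $ 2) / 2"
  "hodge2 1 minkowski F $ 1 $ 3 = (F $ 0 $ 2 - F $ 2 $ 0) / 2"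
  "hodge2 1 minkowski F $ 1 $ 2 = (F $ 3 $ 0 - F $ 0 $ 3) / 2"
  "hodge2 1 minkowski F $ 2 $ 1 = (F $ 0 $ 3 - F $ 3 $ 0) / 2"
  by (simp_all add: hodge2_def volume_element_levi_civita det_minkowski sum_4_0 raise2_minkowski
      levi_civita_repeated levi_civita_values)

text \<open>\<open>x\<close>, \<open>y\<close>, \<open>z\<close> are the electric components 01, 02,
  03; self-duality forces the magnetic components 23, 31, 12 to be \<open>\<i>\<close> times
  these.\<close>

definition sd_form :: "complex \<Rightarrow> complex \<Rightarrow> complex \<Rightarrow> tensor2" where
  "sd_form x y z = (\<chi> a b.
     if a = 0 then (if b = 1 then x else if b = 2 then y else if b = 3 then z else 0)
     else if a = 1 then (if b = 0 then - x else if b = 2 then \<i> * z else if b = 3 then - \<i> * y else 0)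
     else if a = 2 then (if b = 0 then - y else if b = 1 then - \<i> * z else if b = 3 then \<i> * x else 0)
     else (if b = 0 then - z else if b = 1 then \<i> * y else if b = 2 then - \<i> * x else 0))"

text \<open>The metric square of \<open>sd_form x y z\<close> is -2 (x^2 + y^2 + z^2), so this
  factor gives the coordinate forms the norm -1.\<close>

definition inv_sqrt2 :: complex where
  "inv_sqrt2 = complex_of_real (1 / sqrt 2)"

definition sd_basis :: "3 \<Rightarrow> tensor2" where
  "sd_basis k = sd_form (if k = 1 then inv_sqrt2 else 0) (if k = 2 then inv_sqrt2 else 0)
     (if k = 3 then inv_sqrt2 else 0)"

lemma sd_form_nth:
  "sd_form x y z $ 0 $ 0 = 0" "sd_form x y z $ 0 $ 1 = x" "sd_form x y z $ 0 $ 2 = y" "sd_form x y z $ 0 $ 3 = z"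
  "sd_form x y z $ 1 $ 0 = - x" "sd_form x y z $ 1 $ 1 = 0" "sd_form x y z $ 1 $ 2 = \<i> * z" "sd_form x y z $ 1 $ 3 = - \<i> * y"
  "sd_form x y z $ 2 $ 0 = - y" "sd_form x y z $ 2 $ 1 = - \<i> * z" "sd_form x y z $ 2 $ 2 = 0" "sd_form x y z $ 2 $ 3 = \<i> * x"
  "sd_form x y z $ 3 $ 0 = - z" "sd_form x y z $ 3 $ 1 = \<i> * y" "sd_form x y z $ 3 $ 2 = - \<i> * x" "sd_form x y z $ 3 $ 3 = 0"
  by (simp_all add: sd_form_def)

lemma self_dual_minkowskiD:
  assumes "self_dual 1 minkowski F"
  shows "F = sd_form (F $ 0 $ 1) (F $ 0 $ 2) (F $ 0 $ 3)"
proof -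
  have as: "F $ a $ b = - F $ b $ a" for a b
    using assms unfolding self_dual_def by blast
  have "hodge2 1 minkowski F = (\<chi> a b. \<i> * F $ a $ b)"
    using assms unfolding self_dual_def by blast
  then have h: "hodge2 1 minkowski F $ a $ b = \<i> * F $ a $ b" for a b
    by simp
  have d: "F $ a $ a = 0" for a
    using as[of a a] by simp
  show ?thesis
    using h[of 0 1] h[of 0 2] h[of 0 3] as[of 1 0] as[of 2 0] as[of 3 0] as[of 1 3] as[of 3 2] as[of 2 1]
    by (simp add: vec_eq_iff forall_4_0 sd_form_nth d hodge2_minkowski)
qed

lemma inv_sqrt2: "inv_sqrt2 * inv_sqrt2 = 1/2" "inv_sqrt2 * (inv_sqrt2 * x) = x / 2" "cnj inv_sqrt2 = inv_sqrt2"
proof -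
  show *: "inv_sqrt2 * inv_sqrt2 = 1/2"
    by (simp add: inv_sqrt2_def flip: of_real_mult)
  show "inv_sqrt2 * (inv_sqrt2 * x) = x / 2"
    by (simp add: * flip: mult.assoc)
  show "cnj inv_sqrt2 = inv_sqrt2"
    by (simp add: inv_sqrt2_def)
qed

lemmas component_simps = sum_4_0 sum_3 forall_4_0 forall_3 raise2_minkowski sd_form_nth cnj2_def scale2_def
  inv_sqrt2 ginv_minkowski matrix_matrix_mult_def tensor_dot_def

lemma sd_basis_orthonormal:
  "bivector_metric minkowski (sd_basis i) (sd_basis j) = (if i = j then -1 else 0)"
proof -
  have "\<forall>i j. bivector_metric minkowski (sd_basis i) (sd_basis j) = (if i = j then -1 else 0)"
    unfolding forall_3
    by (simp add: bivector_metric_def sd_basis_def component_simps)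
  then show ?thesis by blast
qed

text \<open>The three basis forms and their anti-self-dual conjugates fill the six dimensions of
  bivectors; the overall minus sign is due to their norm -1.\<close>

lemma sd_basis_complete:
  assumes "\<And>a b. F $ a $ b = - F $ b $ a"
  shows "F = - (\<Sum>k\<in>UNIV. bivector_metric minkowski (sd_basis k) F *\<^sub>2 sd_basis k
                 + bivector_metric minkowski (cnj2 (sd_basis k)) F *\<^sub>2 cnj2 (sd_basis k))"
proof -
  have d: "F $ a $ a = 0" for a
    using assms[of a a] by simp
  note a = assms[of 1 0] assms[of 2 0] assms[of 3 0] assms[of 1 3] assms[of 3 2] assms[of 2 1]
  show ?thesis
    by (simp add: vec_eq_iff bivector_metric_def sd_basis_def component_simps d a algebra_simps)
qed

text \<open>Conjugation reverses the relative sign of the electric and magnetic parts, so that their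
  contributions to the metric, equal up to sign, cancel.\<close>

lemma sd_form_orthogonal_cnj:
  "bivector_metric minkowski (cnj2 (sd_form x y z)) (sd_form x' y' z') = 0"
  by (simp add: bivector_metric_def component_simps algebra_simps)


section \<open>Products of self-dual with anti-self-dual bivectors\<close>

definition sd_product :: "3 \<Rightarrow> 3 \<Rightarrow> tensor2" where
  "sd_product k l = tensor_dot minkowski (sd_basis k) (cnj2 (sd_basis l))"

text \<open>Behind the component check: self-dual and anti-self-dual bivectors commute, which makes
  the product symmetric, and they are orthogonal, which makes it traceless.\<close>

lemma sd_product_traceless_symmetric: "sd_product k l \<in> traceless_symmetric minkowski"
proof -
  have "\<forall>k l. sd_product k l \<in> traceless_symmetric minkowski"
    unfolding forall_3 by (simp add: traceless_symmetric_def sd_product_def sd_basis_def component_simps algebra_simps)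
  then show ?thesis by blast
qed

text \<open>The pairing of two products is the product of the bivector metrics of their factors, so
  the two signs -1 cancel.\<close>

lemma sd_product_orthonormal:
  "pairing minkowski (sd_product i j) (sd_product k l) = (if i = k \<and> j = l then 1 else 0)"
proof -
  have "\<forall>i j k l. pairing minkowski (sd_product i j) (sd_product k l) = (if i = k \<and> j = l then 1 else 0)"
    unfolding forall_3 by (simp add: pairing_def sd_product_def sd_basis_def component_simps algebra_simps)
  then show ?thesis by blast
qed

text \<open>Nine orthonormal tensors fill a space of dimension 10 - 1. The trace condition is solved
  for the component 00, which leaves the other nine free.\<close>

lemma sd_product_complete:
  assumes "A \<in> traceless_symmetric minkowski"
  shows "A = (\<Sum>k\<in>UNIV. \<Sum>l\<in>UNIV. pairing minkowski (sd_product k l) A *\<^sub>2 sd_product k l)"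
proof -
  have s: "A $ a $ b = A $ b $ a" for a b
    using assms unfolding traceless_symmetric_def by blast
  have "A $ 1 $ 1 - A $ 0 $ 0 + A $ 2 $ 2 + A $ 3 $ 3 = 0"
    using assms by (simp add: traceless_symmetric_def component_simps)
  then have t: "A $ 0 $ 0 = A $ 1 $ 1 + A $ 2 $ 2 + A $ 3 $ 3"
    by algebra
  note a = s[of 1 0] s[of 2 0] s[of 3 0] s[of 1 3] s[of 3 2] s[of 2 1] t
  show ?thesis
    by (simp add: vec_eq_iff pairing_def sd_product_def sd_basis_def component_simps a algebra_simps)
qed

section \<open>Weyl tensors as forms on Minkowski bivectors\<close>

lemma antisymmetric_sum:
  fixes c X :: "4 \<Rightarrow> 4 \<Rightarrow> complex"
  assumes "\<And>a b. c b a = - c a b" and "\<And>a b. X b a = - X a b"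
  shows "(\<Sum>a\<in>UNIV. \<Sum>b\<in>UNIV. c a b * X a b) =
    2 * (c 0 1 * X 0 1 + c 0 2 * X 0 2 + c 0 3 * X 0 3 + c 1 2 * X 1 2 + c 1 3 * X 1 3 + c 2 3 * X 2 3)"
proof -
  have z: "X a a = 0" for a using assms(2)[of a a] by simp
  show ?thesis
    by (simp add: sum_4_0 z assms(1)[of 1 0] assms(1)[of 2 0] assms(1)[of 3 0] assms(1)[of 2 1]
        assms(1)[of 3 1] assms(1)[of 3 2] assms(2)[of 1 0] assms(2)[of 2 0] assms(2)[of 3 0]
        assms(2)[of 2 1] assms(2)[of 3 1] assms(2)[of 3 2])
qed

text \<open>Using \<open>antisymmetric_sum\<close> in each index pair cuts 256 terms to 36 and
  yields the factor 2 twice. A pair containing the index 0 changes sign when raised.\<close>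

lemma weyl_form_minkowski_expand:
  assumes W: "\<And>a b m n. W $ b $ a $ m $ n = - W $ a $ b $ m $ n"
      "\<And>a b m n. W $ a $ b $ n $ m = - W $ a $ b $ m $ n"
    and F: "\<And>a b. F $ b $ a = - F $ a $ b" and H: "\<And>a b. H $ b $ a = - H $ a $ b"
  defines "w \<equiv> \<lambda>a b. complex_of_real (W $ a $ b $ 2 $ 3) * H $ 2 $ 3 + complex_of_real (W $ a $ b $ 1 $ 3) * H $ 1 $ 3
      + complex_of_real (W $ a $ b $ 1 $ 2) * H $ 1 $ 2 - complex_of_real (W $ a $ b $ 0 $ 1) * H $ 0 $ 1
      - complex_of_real (W $ a $ b $ 0 $ 2) * H $ 0 $ 2 - complex_of_real (W $ a $ b $ 0 $ 3) * H $ 0 $ 3"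
  shows "weyl_form minkowski W F H =
    4 * (w 2 3 * F $ 2 $ 3 + w 1 3 * F $ 1 $ 3 + w 1 2 * F $ 1 $ 2
         - w 0 1 * F $ 0 $ 1 - w 0 2 * F $ 0 $ 2 - w 0 3 * F $ 0 $ 3)"
proof -
  have inner: "(\<Sum>m\<in>UNIV. \<Sum>n\<in>UNIV. complex_of_real (W $ a $ b $ m $ n) * raise2 minkowski H $ m $ n) = 2 * w a b" for a b
  proof (subst antisymmetric_sum)
    show "complex_of_real (W $ a $ b $ n $ m) = - complex_of_real (W $ a $ b $ m $ n)" for m n
      unfolding W(2)[of a b n m] by simp
    show "raise2 minkowski H $ n $ m = - raise2 minkowski H $ m $ n" for m n
      unfolding raise2_minkowski H[of n m] by simp
  qed (simp add: raise2_minkowski w_def)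
  have "weyl_form minkowski W F H = (\<Sum>a\<in>UNIV. \<Sum>b\<in>UNIV. (2 * w a b) * raise2 minkowski F $ a $ b)"
    unfolding weyl_form_def inner[symmetric] sum_distrib_right by (simp add: mult_ac)
  also have "\<dots> = 2 * (2 * w 0 1 * raise2 minkowski F $ 0 $ 1 + 2 * w 0 2 * raise2 minkowski F $ 0 $ 2
      + 2 * w 0 3 * raise2 minkowski F $ 0 $ 3 + 2 * w 1 2 * raise2 minkowski F $ 1 $ 2
      + 2 * w 1 3 * raise2 minkowski F $ 1 $ 3 + 2 * w 2 3 * raise2 minkowski F $ 2 $ 3)"
  proof (rule antisymmetric_sum)
    show "2 * w b a = - (2 * w a b)" for a b
      unfolding w_def W(1)[of b a] by (simp add: algebra_simps)
    show "raise2 minkowski F $ b $ a = - raise2 minkowski F $ a $ b" for a b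
      unfolding raise2_minkowski F[of b a] by simp
  qed
  finally show ?thesis
    by (simp add: raise2_minkowski)
qed

lemma sd_basis_antisymmetric:
  "sd_basis k $ b $ a = - sd_basis k $ a $ b" "cnj2 (sd_basis k) $ b $ a = - cnj2 (sd_basis k) $ a $ b"
proof -
  have "\<forall>a b. sd_form x y z $ b $ a = - sd_form x y z $ a $ b" for x y z
    by (simp add: forall_4_0 sd_form_nth)
  then show 1: "sd_basis k $ b $ a = - sd_basis k $ a $ b" for a b
    unfolding sd_basis_def by blast
  show "cnj2 (sd_basis k) $ b $ a = - cnj2 (sd_basis k) $ a $ b"
    using 1[of b a] by (simp add: cnj2_def)
qed

text \<open>Split each basis form into its electric and magnetic part. The traces make the
  magnetic-magnetic block of \<open>W\<close> minus the electric-electric one and the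
  electric-magnetic block symmetric, which kills the mixed form. The trace on self-dual forms has a
  real part that vanishes by tracelessness and an imaginary part that is the cyclic sum W_0123 +
  W_0231 + W_0312.\<close>

lemma weyl_form_minkowski:
  assumes "weyl_tensor minkowski W"
  shows "weyl_form minkowski W (sd_basis i) (cnj2 (sd_basis j)) = 0"
    and "(\<Sum>k\<in>UNIV. weyl_form minkowski W (sd_basis k) (sd_basis k)) = 0"
proof -
  have w: "W $ b $ a $ m $ n = - W $ a $ b $ m $ n" "W $ a $ b $ n $ m = - W $ a $ b $ m $ n"
    "W $ m $ n $ a $ b = W $ a $ b $ m $ n" for a b m n
    using assms unfolding weyl_tensor_def by (metis minus_minus)+
  have bianchi: "W $ a $ b $ c $ d + W $ a $ c $ d $ b + W $ a $ d $ b $ c = 0" for a b c d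
    using assms unfolding weyl_tensor_def by blast
  have "(\<Sum>a\<in>UNIV. \<Sum>c\<in>UNIV. minkowski $ a $ c * W $ a $ b $ c $ d) = 0" for b d
    using assms unfolding weyl_tensor_def matrix_inv_minkowski by blast
  then have tr: "- W $ 0 $ b $ 0 $ d + W $ 1 $ b $ 1 $ d + W $ 2 $ b $ 2 $ d + W $ 3 $ b $ 3 $ d = 0" for b d
    by (simp add: sum_4_0 minkowski_def)
  have z: "W $ a $ a $ m $ n = 0" "W $ m $ n $ a $ a = 0" for a m n
    using w(1)[of a a m n] w(2)[of m n a a] by simp_all
  \<comment> \<open>Rewriting to a normal form: each index pair and the order of the two pairs are
    fixed, leaving 21 components.\<close>
  note n = w(1)[of 1 0] w(1)[of 2 0] w(1)[of 3 0] w(1)[of 3 1] w(1)[of 3 2] w(1)[of 2 1]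
       w(2)[of _ _ 1 0] w(2)[of _ _ 2 0] w(2)[of _ _ 3 0] w(2)[of _ _ 3 1] w(2)[of _ _ 3 2] w(2)[of _ _ 2 1]
       w(3)[of 0 2 0 1] w(3)[of 0 3 0 1] w(3)[of 0 3 0 2]
       w(3)[of 1 2 0 1] w(3)[of 1 3 0 1] w(3)[of 2 3 0 1]
       w(3)[of 1 2 0 2] w(3)[of 1 3 0 2] w(3)[of 2 3 0 2]
       w(3)[of 1 2 0 3] w(3)[of 1 3 0 3] w(3)[of 2 3 0 3]
       w(3)[of 1 3 1 2] w(3)[of 2 3 1 2] w(3)[of 2 3 1 3]
  note e = weyl_form_minkowski_expand[OF w(1) w(2) sd_basis_antisymmetric(1) sd_basis_antisymmetric(1)]
    weyl_form_minkowski_expand[OF w(1) w(2) sd_basis_antisymmetric(1) sd_basis_antisymmetric(2)]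
  note v = sd_basis_def cnj2_def sd_form_nth inv_sqrt2
  \<comment> \<open>One cyclic identity and ten traces: these 11 relations on 21 components leave
    the ten degrees of freedom of a Weyl tensor. They are linear over the reals, so the goals, split
    into real and imaginary parts, are linear consequences.\<close>
  note T = bianchi[of 0 1 2 3, unfolded z n] tr[of 0 0, unfolded z n] tr[of 1 1, unfolded z n]
      tr[of 2 2, unfolded z n] tr[of 3 3, unfolded z n] tr[of 0 1, unfolded z n] tr[of 0 2, unfolded z n]
      tr[of 0 3, unfolded z n] tr[of 1 2, unfolded z n] tr[of 1 3, unfolded z n] tr[of 2 3, unfolded z n]
  show "(\<Sum>k\<in>UNIV. weyl_form minkowski W (sd_basis k) (sd_basis k)) = 0"
    unfolding sum_3 e by (simp add: v n z algebra_simps complex_eq_iff) (use T in linarith)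
  have "\<forall>i j. weyl_form minkowski W (sd_basis i) (cnj2 (sd_basis j)) = 0"
    unfolding forall_3 e by (intro conjI; simp add: v n z algebra_simps complex_eq_iff; use T in linarith)
  then show "weyl_form minkowski W (sd_basis i) (cnj2 (sd_basis j)) = 0"
    by blast
qed

section \<open>Change to an oriented orthonormal tetrad\<close>

lemma sum_swap2:
  "(\<Sum>a\<in>A. \<Sum>b\<in>B. \<Sum>c\<in>C. \<Sum>d\<in>D. f a b c d) = (\<Sum>c\<in>C. \<Sum>d\<in>D. \<Sum>a\<in>A. \<Sum>b\<in>B. f a b c d)"
proof -
  have "(\<Sum>a\<in>A. \<Sum>b\<in>B. \<Sum>c\<in>C. \<Sum>d\<in>D. f a b c d) = (\<Sum>a\<in>A. \<Sum>c\<in>C. \<Sum>b\<in>B. \<Sum>d\<in>D. f a b c d)"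
    by (rule sum.cong[OF refl], rule sum.swap)
  also have "\<dots> = (\<Sum>c\<in>C. \<Sum>a\<in>A. \<Sum>d\<in>D. \<Sum>b\<in>B. f a b c d)"
    by (subst sum.swap, rule sum.cong[OF refl], rule sum.cong[OF refl], rule sum.swap)
  also have "\<dots> = (\<Sum>c\<in>C. \<Sum>d\<in>D. \<Sum>a\<in>A. \<Sum>b\<in>B. f a b c d)"
    by (rule sum.cong[OF refl], rule sum.swap)
  finally show ?thesis .
qed

lemma sum_rotate:
  "(\<Sum>a\<in>A. \<Sum>b\<in>A. \<Sum>c\<in>A. f a b c) = (\<Sum>a\<in>A. \<Sum>b\<in>A. \<Sum>c\<in>A. f b c a)"
  by (subst sum.swap[of _ A A], rule sum.cong[OF refl])
    (rule sum.swap)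

lemma raise2_matrix: "raise2 g F = ginv g ** F ** transpose (ginv g)"
proof -
  have "raise2 g F $ a $ b = (ginv g ** F ** transpose (ginv g)) $ a $ b" for a b
    unfolding raise2_def matrix_matrix_mult_def transpose_def vec_lambda_beta sum_distrib_right
    by (subst sum.swap, intro sum.cong refl) (simp add: ac_simps)
  then show ?thesis by (simp add: vec_eq_iff)
qed

lemma sum_mult_trace: "(\<Sum>a\<in>UNIV. \<Sum>b\<in>UNIV. A $ a $ b * B $ a $ b) = trace (A ** transpose B)"
  by (simp add: trace_def matrix_matrix_mult_def transpose_def)

lemma pairing_trace: "pairing g F H = trace (F ** transpose (raise2 g H))"
  unfolding pairing_def by (rule sum_mult_trace)

lemma bivector_metric_pairing: "bivector_metric g F H = 1/2 * pairing g F H"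
  by (simp add: bivector_metric_def pairing_def)

lemma traceless_symmetric_matrix:
  "A \<in> traceless_symmetric g \<longleftrightarrow> transpose A = A \<and> trace (ginv g ** transpose A) = 0"
  unfolding traceless_symmetric_def sum_mult_trace
  by (auto simp: transpose_def vec_eq_iff)

definition complexify :: "real^4^4 \<Rightarrow> tensor2" where
  "complexify A = (\<chi> a b. complex_of_real (A $ a $ b))"

lemma complexify_nth [simp]: "complexify A $ a $ b = complex_of_real (A $ a $ b)"
  by (simp add: complexify_def)

lemma complexify_mult: "complexify (A ** B) = complexify A ** complexify B"
  by (simp add: vec_eq_iff matrix_matrix_mult_def)

lemma complexify_transpose: "complexify (transpose A) = transpose (complexify A)"
  by (simp add: vec_eq_iff transpose_def)

lemma complexify_mat_1: "complexify (mat 1) = mat 1"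
  by (simp add: vec_eq_iff mat_def)

lemma ginv_complexify: "ginv g = complexify (matrix_inv g)"
  by (simp add: ginv_def complexify_def)

text \<open>Moves a change of basis from a contravariant tensor to the covariant coefficients
  contracted with it.\<close>

lemma sum_congruence:
  fixes N Z :: "complex^4^4"
  shows "(\<Sum>a\<in>UNIV. \<Sum>b\<in>UNIV. c a b * (N ** Z ** transpose N) $ a $ b) =
    (\<Sum>p\<in>UNIV. \<Sum>q\<in>UNIV. (\<Sum>a\<in>UNIV. \<Sum>b\<in>UNIV. c a b * N $ a $ p * N $ b $ q) * Z $ p $ q)"
proof -
  have "(\<Sum>a\<in>UNIV. \<Sum>b\<in>UNIV. c a b * (N ** Z ** transpose N) $ a $ b) =
      (\<Sum>a\<in>UNIV. \<Sum>b\<in>UNIV. \<Sum>q\<in>UNIV. \<Sum>p\<in>UNIV. c a b * N $ a $ p * N $ b $ q * Z $ p $ q)"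
    by (simp add: matrix_matrix_mult_def transpose_def sum_distrib_left sum_distrib_right ac_simps)
  also have "\<dots> = (\<Sum>q\<in>UNIV. \<Sum>p\<in>UNIV. \<Sum>a\<in>UNIV. \<Sum>b\<in>UNIV. c a b * N $ a $ p * N $ b $ q * Z $ p $ q)"
    by (rule sum_swap2)
  also have "\<dots> = (\<Sum>p\<in>UNIV. \<Sum>q\<in>UNIV. \<Sum>a\<in>UNIV. \<Sum>b\<in>UNIV. c a b * N $ a $ p * N $ b $ q * Z $ p $ q)"
    by (rule sum.swap)
  finally show ?thesis
    by (simp add: sum_distrib_right)
qed

text \<open>The second assumption says that the volume element has component \<open>\<eta>\<^bsub>0123\<^esub> = 1\<close> in the tetrad.\<close>

locale oriented_tetrad =
  fixes g :: "real^4^4" and s :: real and Q :: "real^4^4"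
  assumes tetrad: "transpose Q ** g ** Q = minkowski"
    and oriented: "s * sgn (det Q) = 1"
begin

lemma det_metric: "det Q * det Q * det g = -1"
proof -
  have "det (transpose Q ** g ** Q) = -1"
    by (simp add: tetrad det_minkowski)
  then show ?thesis by (simp add: det_mul ac_simps)
qed

lemma matrix_inv_tetrad: "matrix_inv Q ** Q = mat 1" "Q ** matrix_inv Q = mat 1"
proof -
  have "invertible Q"
    using det_metric by (auto simp: invertible_det_nz)
  then obtain B where "Q ** B = mat 1" by (auto simp: invertible_def)
  with matrix_inv_unique_left[OF this] show "Q ** matrix_inv Q = mat 1" by simp
  then show "matrix_inv Q ** Q = mat 1" by (simp add: matrix_left_right_inverse)
qed

lemma matrix_inv_metric: "matrix_inv g = Q ** minkowski ** transpose Q"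
proof (rule matrix_inv_unique_left)
  have "transpose (matrix_inv Q) ** transpose Q = mat 1"
    by (simp add: matrix_inv_tetrad flip: matrix_transpose_mul)
  then have "transpose (matrix_inv Q) ** (transpose Q ** g ** Q) = g ** Q"
    by (simp add: matrix_mul_assoc)
  then have "g ** Q = transpose (matrix_inv Q) ** minkowski"
    by (simp add: tetrad)
  then have "g ** (Q ** minkowski ** transpose Q) =
      transpose (matrix_inv Q) ** (minkowski ** minkowski) ** transpose Q"
    by (simp add: matrix_mul_assoc)
  also have "\<dots> = mat 1"
    by (simp add: minkowski_square \<open>transpose (matrix_inv Q) ** transpose Q = mat 1\<close>)
  finally show "g ** (Q ** minkowski ** transpose Q) = mat 1" .
qed

text \<open>The columns of \<open>N\<close> are the tetrad vectors, \<open>R\<close> is the inverse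
  transpose, and \<open>\<Phi>\<close> takes the tetrad components of a covariant 2-tensor to its
  components in the given basis.\<close>

definition N :: tensor2 where "N = complexify Q"
definition R :: tensor2 where "R = transpose (complexify (matrix_inv Q))"
definition \<Phi> :: "tensor2 \<Rightarrow> tensor2" where "\<Phi> X = R ** X ** transpose R"

lemma inverse_matrices:
  "transpose R ** N = mat 1" "N ** transpose R = mat 1"
  "transpose N ** R = mat 1" "R ** transpose N = mat 1"
proof -
  show 1: "transpose R ** N = mat 1" "N ** transpose R = mat 1"
    by (simp_all add: N_def R_def matrix_inv_tetrad complexify_mat_1 flip: complexify_mult)
  show "transpose N ** R = mat 1" "R ** transpose N = mat 1"
    using 1[THEN arg_cong[where f = transpose]] by (simp_all add: matrix_transpose_mul)
qed

lemma cancel_matrices: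
  "transpose R ** (N ** X) = X" "N ** (transpose R ** X) = X"
  "transpose N ** (R ** X) = X" "R ** (transpose N ** X) = X"
  by (simp_all add: matrix_mul_assoc inverse_matrices)

lemma ginv_matrix: "ginv g = N ** ginv minkowski ** transpose N"
  by (simp add: ginv_complexify matrix_inv_metric complexify_mult complexify_transpose N_def matrix_inv_minkowski)

lemma transpose_ginv_minkowski: "transpose (ginv minkowski) = ginv minkowski"
  by (auto simp: vec_eq_iff transpose_def ginv_minkowski)

lemmas matrix_calc = matrix_transpose_mul cancel_matrices inverse_matrices transpose_ginv_minkowski

lemma \<Phi>_surj: "\<Phi> (transpose N ** A ** N) = A"
  by (simp add: \<Phi>_def matrix_calc flip: matrix_mul_assoc)

lemma \<Phi>_inv: "transpose N ** \<Phi> X ** N = X"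
  by (simp add: \<Phi>_def matrix_calc flip: matrix_mul_assoc)

lemma transpose_\<Phi>: "transpose (\<Phi> X) = \<Phi> (transpose X)"
  by (simp add: \<Phi>_def matrix_calc flip: matrix_mul_assoc)

lemma raise2_\<Phi>: "raise2 g (\<Phi> X) = N ** raise2 minkowski X ** transpose N"
  by (simp add: raise2_matrix \<Phi>_def ginv_matrix matrix_calc flip: matrix_mul_assoc)

lemma trace_\<Phi>: "trace (R ** X ** transpose N) = trace X"
  by (subst trace_mul_sym) (simp add: matrix_calc matrix_mul_assoc)

lemma pairing_\<Phi>: "pairing g (\<Phi> X) (\<Phi> Y) = pairing minkowski X Y"
proof -
  have "pairing g (\<Phi> X) (\<Phi> Y) = trace (R ** (X ** transpose (raise2 minkowski Y)) ** transpose N)"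
    by (simp add: pairing_trace raise2_\<Phi>) (simp add: \<Phi>_def matrix_calc flip: matrix_mul_assoc)
  then show ?thesis by (simp add: trace_\<Phi> pairing_trace)
qed

lemma tensor_dot_\<Phi>: "tensor_dot g (\<Phi> X) (\<Phi> Y) = \<Phi> (tensor_dot minkowski X Y)"
  by (simp add: tensor_dot_def \<Phi>_def ginv_matrix matrix_calc flip: matrix_mul_assoc)

lemma traceless_symmetric_\<Phi>: "\<Phi> X \<in> traceless_symmetric g \<longleftrightarrow> X \<in> traceless_symmetric minkowski"
proof -
  have "transpose (\<Phi> X) = \<Phi> X \<longleftrightarrow> transpose X = X"
    by (metis transpose_\<Phi> \<Phi>_inv)
  moreover have "trace (ginv g ** transpose (\<Phi> X)) = trace (ginv minkowski ** transpose X)"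
  proof -
    have "trace (ginv g ** transpose (\<Phi> X)) = trace (N ** (ginv minkowski ** transpose X ** transpose R))"
      by (simp add: ginv_matrix transpose_\<Phi>) (simp add: \<Phi>_def matrix_calc flip: matrix_mul_assoc)
    also have "\<dots> = trace (ginv minkowski ** transpose X)"
      by (subst trace_mul_sym) (simp add: matrix_calc flip: matrix_mul_assoc)
    finally show ?thesis .
  qed
  ultimately show ?thesis by (simp add: traceless_symmetric_matrix)
qed

lemma \<Phi>_scale: "\<Phi> (c *\<^sub>2 X) = c *\<^sub>2 \<Phi> X"
  by (simp add: \<Phi>_def vec_eq_iff matrix_matrix_mult_def scale2_def sum_distrib_left sum_distrib_right ac_simps)

lemma \<Phi>_add: "\<Phi> (X + Y) = \<Phi> X + \<Phi> Y"
  by (simp add: \<Phi>_def vec_eq_iff matrix_matrix_mult_def sum.distrib algebra_simps)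

lemma \<Phi>_zero: "\<Phi> 0 = 0"
  by (simp add: \<Phi>_def vec_eq_iff matrix_matrix_mult_def)

lemma \<Phi>_minus: "\<Phi> (- X) = - \<Phi> X"
  using \<Phi>_add[of X "- X"] by (simp add: \<Phi>_zero eq_neg_iff_add_eq_0 add.commute)

lemma \<Phi>_sum: "\<Phi> (\<Sum>i\<in>I. f i) = (\<Sum>i\<in>I. \<Phi> (f i))"
  by (induction I rule: infinite_finite_induct) (simp_all add: \<Phi>_zero \<Phi>_add)

lemma \<Phi>_cnj2: "\<Phi> (cnj2 X) = cnj2 (\<Phi> X)"
  by (simp add: \<Phi>_def R_def vec_eq_iff matrix_matrix_mult_def cnj2_def transpose_def)

text \<open>By \<open>det_metric\<close>, the square root is the inverse of the absolute value of
  \<open>det Q\<close>, so the left side is \<open>s * sgn (det Q)\<close>.\<close>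

lemma oriented_volume: "s * sqrt \<bar>det g\<bar> * det Q = 1"
proof -
  have nz: "det Q \<noteq> 0" using oriented by auto
  have "\<bar>det Q\<bar> * \<bar>det Q\<bar> * \<bar>det g\<bar> = 1"
    unfolding abs_mult[symmetric] det_metric by simp
  moreover have "x * x * y = 1 \<Longrightarrow> x \<noteq> 0 \<Longrightarrow> y = (1 / x)\<^sup>2" for x y :: real
    by (simp add: field_simps power2_eq_square)
  ultimately have "\<bar>det g\<bar> = (1 / \<bar>det Q\<bar>)\<^sup>2"
    using nz by simp
  then have "sqrt \<bar>det g\<bar> = 1 / \<bar>det Q\<bar>"
    by simp
  with oriented nz show ?thesis
    by (simp add: sgn_real_def field_simps split: if_splits)
qed

lemma hodge2_\<Phi>: "hodge2 s g (\<Phi> X) = \<Phi> (hodge2 1 minkowski X)"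
proof -
  define v where "v = s * sqrt \<bar>det g\<bar>"
  define Z where "Z = raise2 minkowski X"
  let ?l = "\<lambda>a b c d. complex_of_real (levi_civita a b c d)"
  have H: "hodge2 s g (\<Phi> X) $ a $ b =
      1/2 * complex_of_real v * (\<Sum>p\<in>UNIV. \<Sum>q\<in>UNIV. (\<Sum>m\<in>UNIV. \<Sum>n\<in>UNIV. ?l a b m n * N $ m $ p * N $ n $ q) * Z $ p $ q)" for a b
    unfolding sum_congruence[symmetric] Z_def raise2_\<Phi>[symmetric]
    by (simp add: hodge2_def volume_element_levi_civita v_def sum_distrib_left ac_simps)
  have "(transpose N ** hodge2 s g (\<Phi> X) ** N) $ a' $ b' = hodge2 1 minkowski X $ a' $ b'" for a' b'
  proof -
    \<comment> \<open>Pulled back to the tetrad, every index of the symbol meets a copy of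
      \<open>N\<close>: two from the pull-back, two from raising the indices of
      \<open>\<Phi> X\<close>. The resulting \<open>det Q\<close> cancels the volume factor
      \<open>v\<close>.\<close>
    have cov: "(\<Sum>a\<in>UNIV. \<Sum>b\<in>UNIV. \<Sum>m\<in>UNIV. \<Sum>n\<in>UNIV. N $ a $ a' * N $ b $ b' * N $ m $ p * N $ n $ q * ?l a b m n)
        = det Q * ?l a' b' p q" for p q
      unfolding N_def complexify_nth of_real_mult[symmetric] of_real_sum[symmetric] levi_civita_covariant ..
    have "(transpose N ** hodge2 s g (\<Phi> X) ** N) $ a' $ b' =
        (\<Sum>a\<in>UNIV. \<Sum>b\<in>UNIV. N $ a $ a' * N $ b $ b' * hodge2 s g (\<Phi> X) $ a $ b)"
      unfolding matrix_matrix_mult_def transpose_def vec_lambda_beta sum_distrib_right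
      by (subst sum.swap) (simp add: ac_simps)
    also have "\<dots> = (\<Sum>a\<in>UNIV. \<Sum>b\<in>UNIV. \<Sum>p\<in>UNIV. \<Sum>q\<in>UNIV. 1/2 * complex_of_real v * Z $ p $ q *
        (\<Sum>m\<in>UNIV. \<Sum>n\<in>UNIV. N $ a $ a' * N $ b $ b' * N $ m $ p * N $ n $ q * ?l a b m n))"
      unfolding H by (simp add: sum_distrib_left sum_distrib_right ac_simps)
    also have "\<dots> = (\<Sum>p\<in>UNIV. \<Sum>q\<in>UNIV. 1/2 * complex_of_real v * Z $ p $ q * (\<Sum>a\<in>UNIV. \<Sum>b\<in>UNIV. 
        \<Sum>m\<in>UNIV. \<Sum>n\<in>UNIV. N $ a $ a' * N $ b $ b' * N $ m $ p * N $ n $ q * ?l a b m n))"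
      by (subst sum_swap2) (simp only: sum_distrib_left)
    also have "\<dots> = (\<Sum>p\<in>UNIV. \<Sum>q\<in>UNIV. 1/2 * complex_of_real (v * det Q) * Z $ p $ q * ?l a' b' p q)"
      unfolding cov by (simp add: ac_simps)
    also have "v * det Q = 1"
      unfolding v_def by (rule oriented_volume)
    also have "(\<Sum>p\<in>UNIV. \<Sum>q\<in>UNIV. 1/2 * complex_of_real 1 * Z $ p $ q * ?l a' b' p q) = hodge2 1 minkowski X $ a' $ b'"
      by (simp add: hodge2_def volume_element_levi_civita det_minkowski Z_def sum_distrib_left ac_simps)
    finally show ?thesis .
  qed
  then have "transpose N ** hodge2 s g (\<Phi> X) ** N = hodge2 1 minkowski X"
    by (simp add: vec_eq_iff)
  then show ?thesis by (metis \<Phi>_surj)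
qed

end

lemma (in oriented_tetrad) self_dual_\<Phi>:
  assumes "self_dual s g (\<Phi> X)"
  shows "self_dual 1 minkowski X"
proof -
  have "hodge2 s g (\<Phi> X) = \<i> *\<^sub>2 \<Phi> X" and a: "\<forall>a b. \<Phi> X $ a $ b = - \<Phi> X $ b $ a"
    using assms unfolding self_dual_def scale2_def by blast+
  then have "\<Phi> (hodge2 1 minkowski X) = \<Phi> (\<i> *\<^sub>2 X)"
    by (simp add: hodge2_\<Phi> \<Phi>_scale)
  then have "hodge2 1 minkowski X = \<i> *\<^sub>2 X"
    by (metis \<Phi>_inv)
  moreover have "transpose (\<Phi> X) $ a $ b = (- \<Phi> X) $ a $ b" for a b
    using a[rule_format, of b a] by (simp add: transpose_def)
  then have "transpose (\<Phi> X) = - \<Phi> X"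
    by (simp add: vec_eq_iff)
  then have "\<Phi> (transpose X) = \<Phi> (- X)"
    by (simp add: transpose_\<Phi> \<Phi>_minus)
  then have t: "transpose X = - X"
    by (metis \<Phi>_inv)
  have "X $ a $ b = - X $ b $ a" for a b
    using arg_cong[OF t, of "\<lambda>M. M $ b $ a"] by (simp add: transpose_def)
  ultimately show ?thesis
    unfolding self_dual_def scale2_def by blast
qed

section \<open>Tetrad components of a Weyl tensor\<close>

definition pull4 :: "real^4^4 \<Rightarrow> real^4^4^4^4 \<Rightarrow> real^4^4^4^4" where
  "pull4 Q W = (\<chi> p q r t. \<Sum>a\<in>UNIV. \<Sum>b\<in>UNIV. \<Sum>m\<in>UNIV. \<Sum>n\<in>UNIV.
     W $ a $ b $ m $ n * Q $ a $ p * Q $ b $ q * Q $ m $ r * Q $ n $ t)"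

lemma (in oriented_tetrad) weyl_form_\<Phi>:
  "weyl_form g W (\<Phi> X) (\<Phi> Y) = weyl_form minkowski (pull4 Q W) X Y"
proof -
  define K where "K = raise2 minkowski X"
  define L where "L = raise2 minkowski Y"
  let ?W = "\<lambda>a b m n. complex_of_real (W $ a $ b $ m $ n)"
  have pull: "complex_of_real (pull4 Q W $ p $ q $ r $ t) =
      (\<Sum>a\<in>UNIV. \<Sum>b\<in>UNIV. \<Sum>m\<in>UNIV. \<Sum>n\<in>UNIV. ?W a b m n * N $ a $ p * N $ b $ q * N $ m $ r * N $ n $ t)" for p q r t
    by (simp add: pull4_def N_def)
  have "weyl_form g W (\<Phi> X) (\<Phi> Y) =
    (\<Sum>a\<in>UNIV. \<Sum>b\<in>UNIV. (\<Sum>m\<in>UNIV. \<Sum>n\<in>UNIV. ?W a b m n * (N ** L ** transpose N) $ m $ n) * (N ** K ** transpose N) $ a $ b)"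
    by (simp add: weyl_form_def raise2_\<Phi> K_def L_def sum_distrib_left sum_distrib_right mult_ac)
  also have "\<dots> = (\<Sum>p\<in>UNIV. \<Sum>q\<in>UNIV. (\<Sum>a\<in>UNIV. \<Sum>b\<in>UNIV. 
      (\<Sum>r\<in>UNIV. \<Sum>t\<in>UNIV. (\<Sum>m\<in>UNIV. \<Sum>n\<in>UNIV. ?W a b m n * N $ m $ r * N $ n $ t) * L $ r $ t)
         * N $ a $ p * N $ b $ q) * K $ p $ q)"
    unfolding sum_congruence ..
  also have "\<dots> = (\<Sum>p\<in>UNIV. \<Sum>q\<in>UNIV. (\<Sum>a\<in>UNIV. \<Sum>b\<in>UNIV. \<Sum>r\<in>UNIV. \<Sum>t\<in>UNIV.
      (\<Sum>m\<in>UNIV. \<Sum>n\<in>UNIV. ?W a b m n * N $ a $ p * N $ b $ q * N $ m $ r * N $ n $ t) * L $ r $ t) * K $ p $ q)"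
    by (simp add: sum_distrib_left sum_distrib_right mult_ac)
  also have "\<dots> = (\<Sum>p\<in>UNIV. \<Sum>q\<in>UNIV. (\<Sum>r\<in>UNIV. \<Sum>t\<in>UNIV. \<Sum>a\<in>UNIV. \<Sum>b\<in>UNIV.
      (\<Sum>m\<in>UNIV. \<Sum>n\<in>UNIV. ?W a b m n * N $ a $ p * N $ b $ q * N $ m $ r * N $ n $ t) * L $ r $ t) * K $ p $ q)"
    by (rule sum.cong[OF refl], rule sum.cong[OF refl], rule arg_cong2[where f = "(*)", OF _ refl]) (rule sum_swap2)
  also have "\<dots> = weyl_form minkowski (pull4 Q W) X Y"
    by (simp add: weyl_form_def pull K_def L_def sum_distrib_left sum_distrib_right mult_ac)
  finally show ?thesis .
qed

lemma (in oriented_tetrad) weyl_tensor_pull4: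
  assumes "weyl_tensor g W"
  shows "weyl_tensor minkowski (pull4 Q W)"
proof -
  have w1: "W $ a $ b $ m $ n = - W $ b $ a $ m $ n"
    and w2: "W $ a $ b $ m $ n = - W $ a $ b $ n $ m"
    and w3: "W $ a $ b $ m $ n = W $ m $ n $ a $ b"
    and w4: "W $ a $ b $ m $ n + W $ a $ m $ n $ b + W $ a $ n $ b $ m = 0"
    and w5: "(\<Sum>a\<in>UNIV. \<Sum>m\<in>UNIV. matrix_inv g $ a $ m * W $ a $ b $ m $ n) = 0" for a b m n
    using assms unfolding weyl_tensor_def by blast+
  have "pull4 Q W $ p $ q $ r $ t = - pull4 Q W $ q $ p $ r $ t" for p q r t
    unfolding pull4_def vec_lambda_beta sum_negf[symmetric]
    by (rule trans[OF sum.swap], intro sum.cong refl, subst w1) (simp add: mult_ac)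
  moreover have "pull4 Q W $ p $ q $ r $ t = - pull4 Q W $ p $ q $ t $ r" for p q r t
    unfolding pull4_def vec_lambda_beta sum_negf[symmetric]
    by (rule sum.cong[OF refl], rule sum.cong[OF refl], rule trans[OF sum.swap], intro sum.cong refl, subst w2) (simp add: mult_ac)
  moreover have "pull4 Q W $ p $ q $ r $ t = pull4 Q W $ r $ t $ p $ q" for p q r t
    unfolding pull4_def vec_lambda_beta
    by (rule trans[OF sum_swap2], intro sum.cong refl, subst w3) (simp add: mult_ac)
  moreover have "pull4 Q W $ p $ q $ r $ t + pull4 Q W $ p $ r $ t $ q + pull4 Q W $ p $ t $ q $ r = 0" for p q r t
  proof -
    \<comment> \<open>The three cyclic terms get the same coefficient \<open>?q\<close> once the
      summation variables are renamed, so the identity for \<open>W\<close> applies inside the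
      sum.\<close>
    let ?q = "\<lambda>a b m n. Q $ a $ p * Q $ b $ q * Q $ m $ r * Q $ n $ t"
    have 1: "pull4 Q W $ p $ q $ r $ t =
        (\<Sum>a\<in>UNIV. \<Sum>b\<in>UNIV. \<Sum>m\<in>UNIV. \<Sum>n\<in>UNIV. W $ a $ b $ m $ n * ?q a b m n)"
      by (simp add: pull4_def mult_ac)
    have 2: "pull4 Q W $ p $ r $ t $ q =
        (\<Sum>a\<in>UNIV. \<Sum>b\<in>UNIV. \<Sum>m\<in>UNIV. \<Sum>n\<in>UNIV. W $ a $ m $ n $ b * ?q a b m n)"
      unfolding pull4_def vec_lambda_beta
      by (rule sum.cong[OF refl], rule trans[OF sum_rotate]) (simp add: mult_ac)
    have 3: "pull4 Q W $ p $ t $ q $ r =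
        (\<Sum>a\<in>UNIV. \<Sum>b\<in>UNIV. \<Sum>m\<in>UNIV. \<Sum>n\<in>UNIV. W $ a $ n $ b $ m * ?q a b m n)"
      unfolding pull4_def vec_lambda_beta
      by (rule sum.cong[OF refl], rule trans[OF sum_rotate], rule trans[OF sum_rotate]) (simp add: mult_ac)
    show ?thesis
      unfolding 1 2 3 sum.distrib[symmetric] distrib_right[symmetric] w4 by simp
  qed
  moreover have "(\<Sum>p\<in>UNIV. \<Sum>r\<in>UNIV. matrix_inv minkowski $ p $ r * pull4 Q W $ p $ q $ r $ t) = 0" for q t
  proof -
    \<comment> \<open>Since the inverse metric is the Minkowski matrix transported by
      \<open>Q\<close>, the trace over tetrad indices becomes the trace of \<open>W\<close> itself
      once the sums over \<open>p\<close> and \<open>r\<close> are innermost.\<close>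
    have inv: "matrix_inv g $ a $ m = (\<Sum>p\<in>UNIV. \<Sum>r\<in>UNIV. Q $ a $ p * minkowski $ p $ r * Q $ m $ r)" for a m
      unfolding matrix_inv_metric matrix_matrix_mult_def transpose_def vec_lambda_beta sum_distrib_right
      by (rule sum.swap)
    have "(\<Sum>p\<in>UNIV. \<Sum>r\<in>UNIV. matrix_inv minkowski $ p $ r * pull4 Q W $ p $ q $ r $ t) =
      (\<Sum>p\<in>UNIV. \<Sum>r\<in>UNIV. \<Sum>a\<in>UNIV. \<Sum>m\<in>UNIV. \<Sum>b\<in>UNIV. \<Sum>n\<in>UNIV.
        minkowski $ p $ r * (W $ a $ b $ m $ n * Q $ a $ p * Q $ b $ q * Q $ m $ r * Q $ n $ t))"
      unfolding matrix_inv_minkowski pull4_def vec_lambda_beta sum_distrib_left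
      by (rule sum.cong[OF refl], rule sum.cong[OF refl], rule sum.cong[OF refl]) (rule sum.swap)
    also have "\<dots> = (\<Sum>a\<in>UNIV. \<Sum>m\<in>UNIV. \<Sum>p\<in>UNIV. \<Sum>r\<in>UNIV. \<Sum>b\<in>UNIV. \<Sum>n\<in>UNIV.
        minkowski $ p $ r * (W $ a $ b $ m $ n * Q $ a $ p * Q $ b $ q * Q $ m $ r * Q $ n $ t))"
      by (rule sum_swap2)
    also have "\<dots> = (\<Sum>a\<in>UNIV. \<Sum>m\<in>UNIV. \<Sum>b\<in>UNIV. \<Sum>n\<in>UNIV. \<Sum>p\<in>UNIV. \<Sum>r\<in>UNIV.
        minkowski $ p $ r * (W $ a $ b $ m $ n * Q $ a $ p * Q $ b $ q * Q $ m $ r * Q $ n $ t))"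
      by (rule sum.cong[OF refl], rule sum.cong[OF refl]) (rule sum_swap2)
    also have "\<dots> = (\<Sum>a\<in>UNIV. \<Sum>m\<in>UNIV. \<Sum>b\<in>UNIV. \<Sum>n\<in>UNIV. 
        matrix_inv g $ a $ m * W $ a $ b $ m $ n * (Q $ b $ q * Q $ n $ t))"
      by (simp add: inv sum_distrib_left sum_distrib_right mult_ac)
    also have "\<dots> = (\<Sum>b\<in>UNIV. \<Sum>n\<in>UNIV. \<Sum>a\<in>UNIV. \<Sum>m\<in>UNIV. 
        matrix_inv g $ a $ m * W $ a $ b $ m $ n * (Q $ b $ q * Q $ n $ t))"
      by (rule sum_swap2)
    also have "\<dots> = 0"
      unfolding sum_distrib_right[symmetric] w5 by simp
    finally show ?thesis .
  qed
  ultimately show ?thesis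
    unfolding weyl_tensor_def by blast
qed

lemma lorentzian_oriented_tetrad:
  assumes "lorentzian g" and "s = 1 \<or> s = -1"
  obtains Q where "oriented_tetrad g s Q"
proof -
  obtain Q where Q: "transpose Q ** g ** Q = minkowski" "invertible Q"
    using assms(1) by (auto simp: lorentzian_def minkowski_def)
  show thesis
  proof (cases "s * sgn (det Q) = 1")
    case True
    with Q that show thesis by (simp add: oriented_tetrad_def)
  next
    case False
    \<comment> \<open>Reversing one spatial axis corrects the orientation and preserves the
      Minkowski matrix.\<close>
    define J :: "real^4^4" where "J = (\<chi> a b. if a = b then (if a = 1 then -1 else 1) else 0)"
    have "det Q \<noteq> 0" using Q(2) by (simp add: invertible_det_nz)
    with False assms(2) have s: "s * sgn (det Q) = -1"
      by (auto simp: sgn_real_def split: if_splits)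
    have "det J = -1"
      by (subst det_diagonal) (auto simp: J_def prod_4_0)
    with s have 1: "s * sgn (det (Q ** J)) = 1"
      by (simp add: det_mul sgn_mult)
    have "transpose (Q ** J) ** g ** (Q ** J) = transpose J ** (transpose Q ** g ** Q) ** J"
      by (simp add: matrix_transpose_mul matrix_mul_assoc)
    also have "\<dots> = minkowski"
      unfolding Q(1) by (simp add: vec_eq_iff forall_4_0 sum_4_0 matrix_matrix_mult_def transpose_def J_def minkowski_def)
    finally show thesis
      using that 1 by (simp add: oriented_tetrad_def)
  qed
qed

section \<open>Bilinearity and symmetry of the contractions\<close>

lemma raise2_add: "raise2 g (F + H) = raise2 g F + raise2 g H"
  by (simp add: raise2_def vec_eq_iff sum.distrib algebra_simps)

lemma raise2_scale: "raise2 g (c *\<^sub>2 F) = c *\<^sub>2 raise2 g F"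
  by (simp add: raise2_def vec_eq_iff scale2_def sum_distrib_left mult_ac)

lemma raise2_cnj2: "raise2 g (cnj2 F) = cnj2 (raise2 g F)"
  by (simp add: raise2_def cnj2_def ginv_def vec_eq_iff)

lemma pairing_add_left: "pairing g (F + F') H = pairing g F H + pairing g F' H"
  by (simp add: pairing_def sum.distrib algebra_simps)

lemma pairing_scale_left: "pairing g (c *\<^sub>2 F) H = c * pairing g F H"
  by (simp add: pairing_def scale2_def sum_distrib_left mult_ac)

lemma pairing_add_right: "pairing g F (H + H') = pairing g F H + pairing g F H'"
  by (simp add: pairing_def raise2_add sum.distrib algebra_simps)

lemma pairing_scale_right: "pairing g F (c *\<^sub>2 H) = c * pairing g F H"
  by (simp add: pairing_def raise2_scale) (simp add: scale2_def sum_distrib_left mult_ac)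

lemma pairing_zero: "pairing g 0 H = 0" "pairing g F 0 = 0"
  by (simp_all add: pairing_def raise2_def)

lemma pairing_minus: "pairing g (- F) H = - pairing g F H" "pairing g F (- H) = - pairing g F H"
  using pairing_add_left[of g F "- F" H] pairing_add_right[of g F H "- H"]
  by (simp_all add: pairing_zero eq_neg_iff_add_eq_0 add.commute)

lemma pairing_diff_right: "pairing g F (H - H') = pairing g F H - pairing g F H'"
  using pairing_add_right[of g F H "- H'"] by (simp add: pairing_minus)

lemma pairing_sum_left: "pairing g (\<Sum>i\<in>I. f i) H = (\<Sum>i\<in>I. pairing g (f i) H)"
  by (induction I rule: infinite_finite_induct) (simp_all add: pairing_zero pairing_add_left)

lemma pairing_sum_right: "pairing g F (\<Sum>i\<in>I. f i) = (\<Sum>i\<in>I. pairing g F (f i))"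
  by (induction I rule: infinite_finite_induct) (simp_all add: pairing_zero pairing_add_right)

lemmas pairing_linear = pairing_add_left pairing_scale_left pairing_add_right pairing_scale_right
  pairing_zero pairing_minus pairing_diff_right pairing_sum_left pairing_sum_right

lemma pairing_cnj2: "pairing g (cnj2 F) (cnj2 H) = cnj (pairing g F H)"
  by (simp add: pairing_def raise2_cnj2) (simp add: cnj2_def)

lemma cnj2_linear: "cnj2 (F + H) = cnj2 F + cnj2 H" "cnj2 (c *\<^sub>2 F) = cnj c *\<^sub>2 cnj2 F"
   "cnj2 (- F) = - cnj2 F" "cnj2 0 = 0"
  by (simp_all add: cnj2_def vec_eq_iff scale2_def)

lemma cnj2_sum: "cnj2 (\<Sum>i\<in>I. f i) = (\<Sum>i\<in>I. cnj2 (f i))"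
  by (induction I rule: infinite_finite_induct) (simp_all add: cnj2_linear)

text \<open>The symmetry is inherited from the Minkowski matrix: the inverse metric is
  \<open>Q ** minkowski ** transpose Q\<close> for a tetrad \<open>Q\<close>.\<close>

lemma matrix_inv_symmetric:
  assumes "lorentzian g"
  shows "matrix_inv g $ a $ b = matrix_inv g $ b $ a"
proof -
  obtain Q where "oriented_tetrad g 1 Q"
    using lorentzian_oriented_tetrad[of g 1] assms by blast
  then interpret oriented_tetrad g 1 Q .
  have "transpose minkowski = minkowski"
    by (auto simp: minkowski_def transpose_def vec_eq_iff)
  then have "transpose (matrix_inv g) = matrix_inv g"
    by (simp add: matrix_inv_metric matrix_transpose_mul matrix_mul_assoc)
  from arg_cong[OF this, of "\<lambda>M. M $ b $ a"] show ?thesis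
    by (simp add: transpose_def)
qed

lemma ginv_symmetric:
  assumes "lorentzian g"
  shows "ginv g $ a $ b = ginv g $ b $ a"
  using matrix_inv_symmetric[OF assms, of a b] by (simp add: ginv_def)

text \<open>The pairing is a trace, so transposition and cyclicity reduce the claim to the symmetry
  of the inverse metric.\<close>

lemma pairing_commute:
  assumes "lorentzian g"
  shows "pairing g F H = pairing g H F"
proof -
  have "transpose (ginv g) = ginv g"
    using ginv_symmetric[OF assms] by (simp add: vec_eq_iff transpose_def)
  then have r: "transpose (raise2 g X) = ginv g ** transpose X ** ginv g" for X
    by (simp add: raise2_matrix matrix_transpose_mul matrix_mul_assoc)
  have "trace (transpose X) = trace X" for X :: tensor2
    by (simp add: trace_def transpose_def)
  from this[of "F ** transpose (raise2 g H)"]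
  have "pairing g F H = trace (raise2 g H ** transpose F)"
    by (simp add: pairing_trace matrix_transpose_mul)
  also have "\<dots> = trace (ginv g ** H ** (ginv g ** transpose F))"
    using \<open>transpose (ginv g) = ginv g\<close> by (simp add: raise2_matrix matrix_mul_assoc)
  also have "\<dots> = trace (H ** (ginv g ** transpose F ** ginv g))"
    by (subst matrix_mul_assoc[symmetric], subst trace_mul_sym) (simp add: matrix_mul_assoc)
  also have "\<dots> = pairing g H F"
    by (simp add: pairing_trace r)
  finally show ?thesis .
qed

lemma weyl_form_linear:
  "weyl_form g W (F + F') H = weyl_form g W F H + weyl_form g W F' H"
  "weyl_form g W (c *\<^sub>2 F) H = c * weyl_form g W F H"
  "weyl_form g W F (H + H') = weyl_form g W F H + weyl_form g W F H'"
  "weyl_form g W F (c *\<^sub>2 H) = c * weyl_form g W F H"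
  "weyl_form g W 0 H = 0" "weyl_form g W F 0 = 0"
  unfolding weyl_form_def raise2_add raise2_scale
  by (simp_all add: sum.distrib distrib_left distrib_right scale2_def sum_distrib_left mult_ac raise2_def[of _ 0])

lemma weyl_form_sum:
  "weyl_form g W (\<Sum>i\<in>I. f i) H = (\<Sum>i\<in>I. weyl_form g W (f i) H)"
  "weyl_form g W F (\<Sum>i\<in>I. f i) = (\<Sum>i\<in>I. weyl_form g W F (f i))"
  by (induction I rule: infinite_finite_induct) (simp_all add: weyl_form_linear)

lemma tensor_dot_linear:
  "tensor_dot g (F + F') H = tensor_dot g F H + tensor_dot g F' H"
  "tensor_dot g (c *\<^sub>2 F) H = c *\<^sub>2 tensor_dot g F H"
  "tensor_dot g F (H + H') = tensor_dot g F H + tensor_dot g F H'"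
  "tensor_dot g F (c *\<^sub>2 H) = c *\<^sub>2 tensor_dot g F H"
  "tensor_dot g 0 H = 0" "tensor_dot g F 0 = 0"
  by (simp_all add: tensor_dot_def matrix_matrix_mult_def vec_eq_iff sum.distrib algebra_simps scale2_def sum_distrib_left)

lemma tensor_dot_sum:
  "tensor_dot g (\<Sum>i\<in>I. f i) H = (\<Sum>i\<in>I. tensor_dot g (f i) H)"
  "tensor_dot g F (\<Sum>i\<in>I. f i) = (\<Sum>i\<in>I. tensor_dot g F (f i))"
  by (induction I rule: infinite_finite_induct) (simp_all add: tensor_dot_linear)

text \<open>Gathers everything the component computations provide, in a form free of tetrads and
  coordinates; later arguments only use these eight properties of \<open>E\<close>.\<close>

lemma exists_sd_basis:
  assumes "lorentzian g" and "s = 1 \<or> s = -1"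
  obtains E :: "3 \<Rightarrow> tensor2" where
    "\<And>i j. bivector_metric g (E i) (E j) = (if i = j then -1 else 0)"
    "\<And>i F. self_dual s g F \<Longrightarrow> bivector_metric g (cnj2 (E i)) F = 0"
    "\<And>F. (\<And>a b. F $ a $ b = - F $ b $ a) \<Longrightarrow>
       F = - (\<Sum>k\<in>UNIV. bivector_metric g (E k) F *\<^sub>2 E k + bivector_metric g (cnj2 (E k)) F *\<^sub>2 cnj2 (E k))"
    "\<And>k l. tensor_dot g (E k) (cnj2 (E l)) \<in> traceless_symmetric g"
    "\<And>i j k l. pairing g (tensor_dot g (E i) (cnj2 (E j))) (tensor_dot g (E k) (cnj2 (E l))) =
       (if i = k \<and> j = l then 1 else 0)"
    "\<And>A. A \<in> traceless_symmetric g \<Longrightarrow> (\<And>k l. pairing g (tensor_dot g (E k) (cnj2 (E l))) A = 0) \<Longrightarrow> A = 0"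
    "\<And>W i j. weyl_tensor g W \<Longrightarrow> weyl_form g W (E i) (cnj2 (E j)) = 0"
    "\<And>W. weyl_tensor g W \<Longrightarrow> (\<Sum>k\<in>UNIV. weyl_form g W (E k) (E k)) = 0"
proof -
  obtain Q where "oriented_tetrad g s Q"
    using lorentzian_oriented_tetrad assms by blast
  then interpret oriented_tetrad g s Q .
  define E where "E k = \<Phi> (sd_basis k)" for k
  have G: "bivector_metric g (\<Phi> X) (\<Phi> Y) = bivector_metric minkowski X Y" for X Y
    by (simp add: bivector_metric_pairing pairing_\<Phi>)
  have c: "cnj2 (E k) = \<Phi> (cnj2 (sd_basis k))" for k
    by (simp add: E_def \<Phi>_cnj2)
  have p: "tensor_dot g (E k) (cnj2 (E l)) = \<Phi> (sd_product k l)" for k l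
    unfolding c unfolding E_def tensor_dot_\<Phi> sd_product_def ..
  have anti: "X $ a $ b = - X $ b $ a" if "\<And>a b. \<Phi> X $ a $ b = - \<Phi> X $ b $ a" for X a b
  proof -
    have "transpose (\<Phi> X) $ a $ b = (- \<Phi> X) $ a $ b" for a b
      using that[of b a] by (simp add: transpose_def)
    then have "transpose (\<Phi> X) = - \<Phi> X" by (simp add: vec_eq_iff)
    then have "transpose X = - X"
      by (metis \<Phi>_inv transpose_\<Phi> \<Phi>_minus)
    from arg_cong[OF this, of "\<lambda>M. M $ b $ a"] show ?thesis by (simp add: transpose_def)
  qed
  have surj: "\<exists>X. A = \<Phi> X" for A
    by (metis \<Phi>_surj)
  show thesis
  proof (rule that[of E])
    show "bivector_metric g (E i) (E j) = (if i = j then -1 else 0)" for i j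
      unfolding E_def G by (rule sd_basis_orthonormal)
    show "bivector_metric g (cnj2 (E i)) F = 0" if "self_dual s g F" for i F
    proof -
      obtain X where X: "F = \<Phi> X" using surj by blast
      with that have "self_dual 1 minkowski X" using self_dual_\<Phi> by simp
      then show ?thesis
        unfolding c X G sd_basis_def by (metis self_dual_minkowskiD sd_form_orthogonal_cnj)
    qed
    show "F = - (\<Sum>k\<in>UNIV. bivector_metric g (E k) F *\<^sub>2 E k + bivector_metric g (cnj2 (E k)) F *\<^sub>2 cnj2 (E k))"
      if F: "\<And>a b. F $ a $ b = - F $ b $ a" for F
    proof -
      obtain X where X: "F = \<Phi> X" using surj by blast
      then have "X $ a $ b = - X $ b $ a" for a b
        using anti[of X] F by blast
      from sd_basis_complete[OF this]
      have "\<Phi> X = \<Phi> (- (\<Sum>k\<in>UNIV. bivector_metric minkowski (sd_basis k) X *\<^sub>2 sd_basis k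
                 + bivector_metric minkowski (cnj2 (sd_basis k)) X *\<^sub>2 cnj2 (sd_basis k)))"
        by simp
      then show ?thesis
        unfolding c unfolding X E_def G by (simp add: \<Phi>_minus \<Phi>_sum \<Phi>_add \<Phi>_scale)
    qed
    show "tensor_dot g (E k) (cnj2 (E l)) \<in> traceless_symmetric g" for k l
      unfolding p traceless_symmetric_\<Phi> by (rule sd_product_traceless_symmetric)
    show "pairing g (tensor_dot g (E i) (cnj2 (E j))) (tensor_dot g (E k) (cnj2 (E l))) =
       (if i = k \<and> j = l then 1 else 0)" for i j k l
      unfolding p pairing_\<Phi> by (rule sd_product_orthonormal)
    show "A = 0" if A: "A \<in> traceless_symmetric g"
      and z: "\<And>k l. pairing g (tensor_dot g (E k) (cnj2 (E l))) A = 0" for A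
    proof -
      obtain X where X: "A = \<Phi> X" using surj by blast
      have "X \<in> traceless_symmetric minkowski" using A unfolding X traceless_symmetric_\<Phi> .
      moreover have "pairing minkowski (sd_product k l) X = 0" for k l
        using z[of k l] unfolding p X pairing_\<Phi> .
      ultimately have "X = (\<Sum>k\<in>UNIV. \<Sum>l\<in>UNIV. 0 *\<^sub>2 sd_product k l)"
        using sd_product_complete[of X] by simp
      then have "X = 0" by simp
      then show ?thesis by (simp add: X \<Phi>_zero)
    qed
    show "weyl_form g W (E i) (cnj2 (E j)) = 0" if "weyl_tensor g W" for W i j
      unfolding c unfolding E_def weyl_form_\<Phi>
      by (rule weyl_form_minkowski(1)[OF weyl_tensor_pull4[OF that]])
    show "(\<Sum>k\<in>UNIV. weyl_form g W (E k) (E k)) = 0" if "weyl_tensor g W" for W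
      unfolding E_def weyl_form_\<Phi>
      by (rule weyl_form_minkowski(2)[OF weyl_tensor_pull4[OF that]])
  qed
qed

section \<open>Orthonormal frames of self-dual bivectors\<close>

lemma bivector_metric_linear:
  "bivector_metric g (F + F') H = bivector_metric g F H + bivector_metric g F' H"
  "bivector_metric g (c *\<^sub>2 F) H = c * bivector_metric g F H"
  "bivector_metric g F (H + H') = bivector_metric g F H + bivector_metric g F H'"
  "bivector_metric g F (c *\<^sub>2 H) = c * bivector_metric g F H"
  "bivector_metric g F (- H) = - bivector_metric g F H"
  by (simp_all add: bivector_metric_pairing pairing_linear distrib_left)

lemma bivector_metric_sum:
  "bivector_metric g (\<Sum>i\<in>I. f i) H = (\<Sum>i\<in>I. bivector_metric g (f i) H)"
  "bivector_metric g F (\<Sum>i\<in>I. f i) = (\<Sum>i\<in>I. bivector_metric g F (f i))"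
  by (simp_all add: bivector_metric_pairing pairing_linear sum_divide_distrib)

lemma bivector_metric_cnj2: "bivector_metric g (cnj2 F) (cnj2 H) = cnj (bivector_metric g F H)"
  by (simp add: bivector_metric_pairing pairing_cnj2)

lemma bivector_metric_commute: "lorentzian g \<Longrightarrow> bivector_metric g F H = bivector_metric g H F"
  by (simp add: bivector_metric_pairing pairing_commute[of g F H])

lemma traceless_symmetric_subspace: "ctensor.subspace (traceless_symmetric g)"
proof (rule ctensor.subspaceI)
  show "0 \<in> traceless_symmetric g"
    by (simp add: traceless_symmetric_def)
  show "A + B \<in> traceless_symmetric g" if "A \<in> traceless_symmetric g" "B \<in> traceless_symmetric g" for A B
    using that by (simp add: traceless_symmetric_def sum.distrib distrib_left)
  show "c *\<^sub>2 A \<in> traceless_symmetric g" if "A \<in> traceless_symmetric g" for c A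
  proof -
    have "(\<Sum>a\<in>UNIV. \<Sum>b\<in>UNIV. ginv g $ a $ b * (c * A $ a $ b)) =
        c * (\<Sum>a\<in>UNIV. \<Sum>b\<in>UNIV. ginv g $ a $ b * A $ a $ b)"
      by (simp add: sum_distrib_left mult_ac)
    then show ?thesis
      using that by (simp add: traceless_symmetric_def scale2_def)
  qed
qed

locale sd_frame =
  fixes g :: "real^4^4" and s :: real and U :: "3 \<Rightarrow> tensor2"
  assumes lorentzian: "lorentzian g" and sign: "s = 1 \<or> s = -1"
    and self_dual: "self_dual s g (U i)"
    and orthonormal: "bivector_metric g (U i) (U j) = (if i = j then -1 else 0)"
begin

definition P :: "3 \<Rightarrow> 3 \<Rightarrow> tensor2" where
  "P i j = tensor_dot g (U i) (cnj2 (U j))"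

lemma antisymmetric: "U i $ a $ b = - U i $ b $ a"
  using self_dual[of i] unfolding self_dual_def by blast

lemma antisymmetric_cnj2: "cnj2 (U i) $ a $ b = - cnj2 (U i) $ b $ a"
  using antisymmetric[of i a b] by (simp add: cnj2_def)

lemma orthonormal_cnj2: "bivector_metric g (cnj2 (U i)) (cnj2 (U j)) = (if i = j then -1 else 0)"
  by (simp add: bivector_metric_cnj2 orthonormal)

lemma frame_properties:
  shows anti_self_dual_orthogonal: "\<And>i F. self_dual s g F \<Longrightarrow> bivector_metric g (cnj2 (U i)) F = 0"
    and bivector_expansion: "\<And>F. (\<And>a b. F $ a $ b = - F $ b $ a) \<Longrightarrow>
       F = - (\<Sum>k\<in>UNIV. bivector_metric g (U k) F *\<^sub>2 U k + bivector_metric g (cnj2 (U k)) F *\<^sub>2 cnj2 (U k))"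
    and P_traceless_symmetric: "\<And>i j. P i j \<in> traceless_symmetric g"
    and P_orthonormal: "\<And>i j k l. pairing g (P i j) (P k l) = (if i = k \<and> j = l then 1 else 0)"
    and P_complete: "\<And>A. A \<in> traceless_symmetric g \<Longrightarrow> (\<And>i j. pairing g (P i j) A = 0) \<Longrightarrow> A = 0"
    and weyl_form_mixed: "\<And>W i j. weyl_tensor g W \<Longrightarrow> weyl_form g W (U i) (cnj2 (U j)) = 0"
    and weyl_form_trace: "\<And>W. weyl_tensor g W \<Longrightarrow> (\<Sum>k\<in>UNIV. weyl_form g W (U k) (U k)) = 0"
proof -
  obtain E :: "3 \<Rightarrow> tensor2" where
    E_orth: "\<And>i j. bivector_metric g (E i) (E j) = (if i = j then -1 else 0)" and
    E_sd: "\<And>i F. self_dual s g F \<Longrightarrow> bivector_metric g (cnj2 (E i)) F = 0" and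
    E_complete: "\<And>F. (\<And>a b. F $ a $ b = - F $ b $ a) \<Longrightarrow>
       F = - (\<Sum>k\<in>UNIV. bivector_metric g (E k) F *\<^sub>2 E k + bivector_metric g (cnj2 (E k)) F *\<^sub>2 cnj2 (E k))" and
    PE_ts: "\<And>k l. tensor_dot g (E k) (cnj2 (E l)) \<in> traceless_symmetric g" and
    PE_orth: "\<And>i j k l. pairing g (tensor_dot g (E i) (cnj2 (E j))) (tensor_dot g (E k) (cnj2 (E l))) =
       (if i = k \<and> j = l then 1 else 0)" and
    PE_complete: "\<And>A. A \<in> traceless_symmetric g \<Longrightarrow> (\<And>k l. pairing g (tensor_dot g (E k) (cnj2 (E l))) A = 0) \<Longrightarrow> A = 0" and
    W_mixed: "\<And>W i j. weyl_tensor g W \<Longrightarrow> weyl_form g W (E i) (cnj2 (E j)) = 0" and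
    W_trace: "\<And>W. weyl_tensor g W \<Longrightarrow> (\<Sum>k\<in>UNIV. weyl_form g W (E k) (E k)) = 0"
  proof (rule exists_sd_basis[OF lorentzian sign], goal_cases)
    case (1 E)
    show ?case by (rule that[of E]) (fact 1)+
  qed
  \<comment> \<open>\<open>c\<close> is a complex orthogonal matrix; completeness carries over from \<open>E\<close> to \<open>U\<close> because
    what is orthogonal to all \<open>U\<close>-products is orthogonal to all \<open>E\<close>-products.\<close>
  define c where "c i k = - bivector_metric g (E k) (U i)" for i k
  define Q :: "complex^3^3" where "Q = (\<chi> i k. c i k)"
  let ?PE = "\<lambda>k l. tensor_dot g (E k) (cnj2 (E l))"
  have U: "U i = (\<Sum>k\<in>UNIV. c i k *\<^sub>2 E k)" for i
  proof -
    have "U i = - (\<Sum>k\<in>UNIV. bivector_metric g (E k) (U i) *\<^sub>2 E k)"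
      using E_complete[OF antisymmetric, of i] by (simp add: E_sd[OF self_dual])
    then show ?thesis by (simp add: c_def sum_negf)
  qed
  have rows0: "- bivector_metric g (U i) (U j) = (\<Sum>k\<in>UNIV. c i k * c j k)" for i j
    by (subst U, subst U) (simp add: bivector_metric_sum bivector_metric_linear E_orth if_distrib sum_negf mult_ac cong: if_cong)
  have rows: "(\<Sum>k\<in>UNIV. c i k * c j k) = (if i = j then 1 else 0)" for i j
    unfolding rows0[symmetric] orthonormal by simp
  \<comment> \<open>A one-sided inverse of a square matrix is two-sided, so the row relations yield
    the column relations \<open>cc\<close>, which invert the expansion of \<open>U\<close> in
    \<open>E\<close>.\<close>
  then have "Q ** transpose Q = mat 1"
    by (simp add: Q_def matrix_matrix_mult_def transpose_def vec_eq_iff mat_def)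
  then have "transpose Q ** Q = mat 1"
    by (simp add: matrix_left_right_inverse)
  then have "(transpose Q ** Q) $ k $ l = (if k = l then 1 else 0)" for k l
    by (simp add: mat_def)
  then have cc: "(\<Sum>i\<in>UNIV. c i k * c i l) = (if k = l then 1 else 0)" for k l
    by (simp add: Q_def matrix_matrix_mult_def transpose_def)
  have E: "E k = (\<Sum>i\<in>UNIV. c i k *\<^sub>2 U i)" for k
  proof -
    have "(\<Sum>i\<in>UNIV. c i k *\<^sub>2 U i) = (\<Sum>i\<in>UNIV. \<Sum>l\<in>UNIV. (c i k * c i l) *\<^sub>2 E l)"
      unfolding U by (simp add: ctensor.scale_sum_right)
    also have "\<dots> = (\<Sum>l\<in>UNIV. (\<Sum>i\<in>UNIV. c i k * c i l) *\<^sub>2 E l)"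
      by (subst sum.swap) (simp add: ctensor.scale_sum_left)
    also have "\<dots> = (\<Sum>l\<in>UNIV. if k = l then E l else 0)"
      unfolding cc by (intro sum.cong) auto
    finally show ?thesis by simp
  qed
  \<comment> \<open>The second factor is conjugated, so the products change by \<open>c\<close>
    tensored with its conjugate. This matrix is again orthogonal, which is what the bilinear pairing
    requires.\<close>
  have P: "P i j = (\<Sum>k\<in>UNIV. \<Sum>l\<in>UNIV. (c i k * cnj (c j l)) *\<^sub>2 ?PE k l)" for i j
    unfolding P_def U
    by (simp add: cnj2_sum cnj2_linear tensor_dot_sum tensor_dot_linear ctensor.scale_sum_right) (subst sum.swap, simp add: mult_ac)
  have PE: "?PE k l = (\<Sum>i\<in>UNIV. \<Sum>j\<in>UNIV. (c i k * cnj (c j l)) *\<^sub>2 P i j)" for k l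
    unfolding P_def E
    by (simp add: cnj2_sum cnj2_linear tensor_dot_sum tensor_dot_linear ctensor.scale_sum_right) (subst sum.swap, simp add: mult_ac)
  show sd: "bivector_metric g (cnj2 (U i)) F = 0" if "self_dual s g F" for i F
    unfolding U by (simp add: cnj2_sum cnj2_linear bivector_metric_sum bivector_metric_linear E_sd[OF that])
  show "F = - (\<Sum>k\<in>UNIV. bivector_metric g (U k) F *\<^sub>2 U k + bivector_metric g (cnj2 (U k)) F *\<^sub>2 cnj2 (U k))"
    if F: "\<And>a b. F $ a $ b = - F $ b $ a" for F
  proof -
    \<comment> \<open>\<open>D\<close> is the defect of the expansion. Being orthogonal to all
      \<open>U k\<close> and their conjugates, it is orthogonal to all \<open>E k\<close> and
      theirs, and the expansion in \<open>E\<close> shows that it is 0.\<close>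
    define D where "D = F + (\<Sum>k\<in>UNIV. bivector_metric g (U k) F *\<^sub>2 U k + bivector_metric g (cnj2 (U k)) F *\<^sub>2 cnj2 (U k))"
    have mixed: "bivector_metric g (cnj2 (U i)) (U j) = 0" "bivector_metric g (U i) (cnj2 (U j)) = 0" for i j
      using sd[OF self_dual] bivector_metric_commute[OF lorentzian] by metis+
    have delta: "x * (if b then -1 else 0) = (if b then - x else 0)" for x :: complex and b
      by simp
    have 1: "bivector_metric g (U i) D = 0" "bivector_metric g (cnj2 (U i)) D = 0" for i
      unfolding D_def
      by (simp_all add: bivector_metric_linear bivector_metric_sum orthonormal orthonormal_cnj2 mixed delta)
    then have 2: "bivector_metric g (E i) D = 0" "bivector_metric g (cnj2 (E i)) D = 0" for i
      unfolding E by (simp_all add: cnj2_sum cnj2_linear bivector_metric_linear bivector_metric_sum)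
    have "D $ a $ b = - D $ b $ a" for a b
      unfolding D_def
      by (simp add: scale2_def F[of a b] antisymmetric[of _ a b] antisymmetric_cnj2[of _ a b] sum.distrib sum_negf algebra_simps)
    from E_complete[OF this] have "D = 0" by (simp add: 2)
    then show ?thesis unfolding D_def by (simp add: eq_neg_iff_add_eq_0)
  qed
  show "P i j \<in> traceless_symmetric g" for i j
    unfolding P
    by (intro ctensor.subspace_sum[OF traceless_symmetric_subspace]
        ctensor.subspace_scale[OF traceless_symmetric_subspace] PE_ts)
  show "pairing g (P i j) (P k l) = (if i = k \<and> j = l then 1 else 0)" for i j k l
  proof -
    \<comment> \<open>Nested conditionals let the double sum collapse one index at a time.\<close>
    have "f p' q' * (if p = p' \<and> q = q' then 1 else 0) = (if q = q' then if p = p' then f p' q' else 0 else 0)"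
      for f :: "3 \<Rightarrow> 3 \<Rightarrow> complex" and p q p' q'
      by simp
    then have delta: "(\<Sum>p'\<in>UNIV. \<Sum>q'\<in>UNIV. f p' q' * (if p = p' \<and> q = q' then 1 else 0)) = f p q"
      for f :: "3 \<Rightarrow> 3 \<Rightarrow> complex" and p q
      by simp
    have "pairing g (P i j) (P k l) =
       (\<Sum>p\<in>UNIV. \<Sum>q\<in>UNIV. \<Sum>p'\<in>UNIV. \<Sum>q'\<in>UNIV. (c i p * cnj (c j q)) * (c k p' * cnj (c l q')) *
          (if p = p' \<and> q = q' then 1 else 0))"
      by (subst P, subst P) (simp add: pairing_linear PE_orth sum_distrib_left mult_ac, rule sum_swap2)
    also have "\<dots> = (\<Sum>p\<in>UNIV. \<Sum>q\<in>UNIV. (c i p * cnj (c j q)) * (c k p * cnj (c l q)))"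
      unfolding delta ..
    also have "\<dots> = (\<Sum>p\<in>UNIV. c i p * c k p) * cnj (\<Sum>q\<in>UNIV. c j q * c l q)"
      by (simp add: sum_product mult_ac)
    also have "\<dots> = (if i = k \<and> j = l then 1 else 0)"
      by (simp add: rows)
    finally show ?thesis .
  qed
  show "A = 0" if "A \<in> traceless_symmetric g" "\<And>i j. pairing g (P i j) A = 0" for A
    by (rule PE_complete[OF that(1)]) (simp add: PE pairing_linear that(2))
  show "weyl_form g W (U i) (cnj2 (U j)) = 0" if "weyl_tensor g W" for W i j
    unfolding U by (simp add: cnj2_sum cnj2_linear weyl_form_linear weyl_form_sum W_mixed[OF that])
  show "(\<Sum>k\<in>UNIV. weyl_form g W (U k) (U k)) = 0" if "weyl_tensor g W" for W
  proof -
    have "(\<Sum>i\<in>UNIV. weyl_form g W (U i) (U i)) =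
       (\<Sum>i\<in>UNIV. \<Sum>k\<in>UNIV. \<Sum>l\<in>UNIV. (c i k * c i l) * weyl_form g W (E k) (E l))"
      unfolding U
      by (simp add: weyl_form_linear weyl_form_sum sum_distrib_left mult_ac)
        (rule sum.cong[OF refl], subst sum.swap, simp add: mult_ac)
    also have "\<dots> = (\<Sum>k\<in>UNIV. \<Sum>i\<in>UNIV. \<Sum>l\<in>UNIV. (c i k * c i l) * weyl_form g W (E k) (E l))"
      by (rule sum.swap)
    also have "\<dots> = (\<Sum>k\<in>UNIV. \<Sum>l\<in>UNIV. \<Sum>i\<in>UNIV. (c i k * c i l) * weyl_form g W (E k) (E l))"
      by (rule sum.cong[OF refl]) (rule sum.swap)
    also have "\<dots> = (\<Sum>k\<in>UNIV. \<Sum>l\<in>UNIV. (if k = l then 1 else 0) * weyl_form g W (E k) (E l))"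
      unfolding sum_distrib_right[symmetric] cc ..
    also have "\<dots> = (\<Sum>k\<in>UNIV. weyl_form g W (E k) (E k))"
      by (simp add: if_distrib if_distribR cong: if_cong)
    finally show ?thesis using W_trace[OF that] by simp
  qed
qed

end

section \<open>The Weyl tensor in an eigenframe\<close>

lemma hodge2_add: "hodge2 s g (F + H) = hodge2 s g F + hodge2 s g H"
  by (simp add: hodge2_def raise2_add vec_eq_iff sum.distrib algebra_simps)

lemma hodge2_scale: "hodge2 s g (c *\<^sub>2 F) = c *\<^sub>2 hodge2 s g F"
  by (simp add: hodge2_def raise2_scale vec_eq_iff) (simp add: scale2_def sum_distrib_left mult_ac)

lemma hodge2_zero: "hodge2 s g 0 = 0"
  using hodge2_scale[of s g 0 0] by simp

lemma hodge2_sum: "hodge2 s g (\<Sum>i\<in>I. f i) = (\<Sum>i\<in>I. hodge2 s g (f i))"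
  by (induction I rule: infinite_finite_induct) (simp_all add: hodge2_zero hodge2_add)

lemma hodge2_minus: "hodge2 s g (- F) = - hodge2 s g F"
  using hodge2_add[of s g F "- F"] by (simp add: hodge2_zero eq_neg_iff_add_eq_0 add.commute)

lemma hodge2_cnj2: "hodge2 s g (cnj2 F) = cnj2 (hodge2 s g F)"
  by (simp add: hodge2_def raise2_cnj2 vec_eq_iff) (simp add: cnj2_def)

definition complexify4 :: "real^4^4^4^4 \<Rightarrow> tensor4" where
  "complexify4 W = (\<chi> a b c d. complex_of_real (W $ a $ b $ c $ d))"

lemma sd_weyl_complexify4:
  "sd_weyl s g W $ a $ b $ m $ n = 1/2 * (complexify4 W $ a $ b $ m $ n - \<i> * hodge4 s g (complexify4 W) $ a $ b $ m $ n)"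
  by (simp add: sd_weyl_def complexify4_def Let_def)

text \<open>\<open>hodge4\<close> dualises the first index pair while the action contracts the
  second, so dualising the tensor amounts to dualising the result.\<close>

lemma bivector_action_sd_weyl:
  fixes g W
  defines "A \<equiv> bivector_action g (complexify4 W)"
  shows "bivector_action g (sd_weyl s g W) F = (1/2) *\<^sub>2 (A F - \<i> *\<^sub>2 hodge2 s g (A F))"
proof -
  let ?W = "complexify4 W" and ?K = "raise2 g F"
  have A: "A F = (\<Sum>m\<in>UNIV. \<Sum>n\<in>UNIV. (1/2 * ?K $ m $ n) *\<^sub>2 (\<chi> r q. ?W $ r $ q $ m $ n))"
    by (simp add: A_def bivector_action_def vec_eq_iff scale2_def sum_distrib_left mult_ac)
  have "hodge2 s g (A F) $ a $ b = 1/2 * (\<Sum>m\<in>UNIV. \<Sum>n\<in>UNIV. hodge4 s g ?W $ a $ b $ m $ n * ?K $ m $ n)" for a b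
    unfolding A by (simp add: hodge2_sum hodge2_scale hodge4_def) (simp add: scale2_def sum_distrib_left mult_ac)
  then show ?thesis
    by (simp add: vec_eq_iff scale2_def bivector_action_def sd_weyl_complexify4 A_def
        sum_distrib_left sum_subtractf[symmetric] algebra_simps)
qed

lemma bivector_action_pairing: "bivector_action g X F $ a $ b = bivector_metric g (X $ a $ b) F"
  by (simp add: bivector_action_def bivector_metric_def)

lemma weyl_form_action:
  assumes "lorentzian g"
  shows "bivector_metric g F (bivector_action g (complexify4 W) H) = 1/4 * weyl_form g W F H"
proof -
  have "bivector_metric g F (bivector_action g (complexify4 W) H) =
      bivector_metric g (bivector_action g (complexify4 W) H) F"
    by (rule bivector_metric_commute[OF assms])
  also have "\<dots> = 1/4 * weyl_form g W F H"
    by (simp add: bivector_metric_def bivector_action_def weyl_form_def complexify4_def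
        sum_distrib_left sum_distrib_right mult_ac)
  finally show ?thesis .
qed

lemma weyl_form_commute:
  assumes "weyl_tensor g W"
  shows "weyl_form g W F H = weyl_form g W H F"
proof -
  have w: "W $ a $ b $ m $ n = W $ m $ n $ a $ b" for a b m n
    using assms unfolding weyl_tensor_def by blast
  show ?thesis
    unfolding weyl_form_def
    by (rule trans[OF sum_swap2], intro sum.cong refl, subst w) (simp add: mult_ac)
qed

locale sd_eigenframe = sd_frame +
  fixes W :: "real^4^4^4^4" and \<rho> :: "3 \<Rightarrow> complex"
  assumes weyl: "weyl_tensor g W"
    and eigen: "bivector_action g (sd_weyl s g W) (U i) = \<rho> i *\<^sub>2 U i"
begin

abbreviation (input) w :: tensor4 where "w \<equiv> sd_weyl s g W"
abbreviation (input) A :: "tensor2 \<Rightarrow> tensor2" where "A \<equiv> bivector_action g (complexify4 W)"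

lemma W_antisymmetric:
  "W $ a $ b $ m $ n = - W $ b $ a $ m $ n" "W $ a $ b $ m $ n = - W $ a $ b $ n $ m"
  using weyl unfolding weyl_tensor_def by blast+

lemma action_antisymmetric: "A F $ a $ b = - A F $ b $ a"
  unfolding bivector_action_def complexify4_def vec_lambda_beta W_antisymmetric(1)[of a b] by (simp add: sum_negf)

lemma hodge2_frame: "hodge2 s g (U i) = \<i> *\<^sub>2 U i" "hodge2 s g (cnj2 (U i)) = - \<i> *\<^sub>2 cnj2 (U i)"
proof -
  show 1: "hodge2 s g (U i) = \<i> *\<^sub>2 U i"
    using self_dual[of i] unfolding self_dual_def scale2_def by blast
  show "hodge2 s g (cnj2 (U i)) = - \<i> *\<^sub>2 cnj2 (U i)"
    by (simp add: hodge2_cnj2 1 cnj2_linear)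
qed

text \<open>As the mixed block of the Weyl form vanishes, \<open>A (U j)\<close> has no component
  along the conjugate frame, nor \<open>A (cnj2 (U j))\<close> along the frame. Each image thus
  stays in its own duality class.\<close>

lemma hodge2_action: "hodge2 s g (A (U j)) = \<i> *\<^sub>2 A (U j)"
  "hodge2 s g (A (cnj2 (U j))) = - \<i> *\<^sub>2 A (cnj2 (U j))"
proof -
  define F where "F = A (U j)"
  have "bivector_metric g (cnj2 (U k)) F = 0" for k
    unfolding F_def weyl_form_action[OF lorentzian]
    using weyl_form_mixed[OF weyl] weyl_form_commute[OF weyl] by simp
  then have *: "F = - (\<Sum>k\<in>UNIV. bivector_metric g (U k) F *\<^sub>2 U k)"
    using bivector_expansion[of F, unfolded F_def, OF action_antisymmetric, folded F_def] by simp
  have "hodge2 s g (- (\<Sum>k\<in>UNIV. c k *\<^sub>2 U k)) = \<i> *\<^sub>2 (- (\<Sum>k\<in>UNIV. c k *\<^sub>2 U k))" for c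
    by (simp add: hodge2_minus hodge2_sum hodge2_scale hodge2_frame ctensor.scale_minus_right ctensor.scale_sum_right mult_ac)
  from this[of "\<lambda>k. bivector_metric g (U k) F"] have "hodge2 s g F = \<i> *\<^sub>2 F"
    unfolding *[symmetric] .
  then show "hodge2 s g (A (U j)) = \<i> *\<^sub>2 A (U j)"
    by (simp add: F_def)
next
  define F where "F = A (cnj2 (U j))"
  have "bivector_metric g (U k) F = 0" for k
    unfolding F_def weyl_form_action[OF lorentzian]
    using weyl_form_mixed[OF weyl] by simp
  then have *: "F = - (\<Sum>k\<in>UNIV. bivector_metric g (cnj2 (U k)) F *\<^sub>2 cnj2 (U k))"
    using bivector_expansion[of F, unfolded F_def, OF action_antisymmetric, folded F_def] by simp
  have "hodge2 s g (- (\<Sum>k\<in>UNIV. c k *\<^sub>2 cnj2 (U k))) = - \<i> *\<^sub>2 (- (\<Sum>k\<in>UNIV. c k *\<^sub>2 cnj2 (U k)))" for c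
    by (simp add: hodge2_minus hodge2_sum hodge2_scale hodge2_frame ctensor.scale_minus_right ctensor.scale_sum_right mult_ac)
  from this[of "\<lambda>k. bivector_metric g (cnj2 (U k)) F"] have "hodge2 s g F = - \<i> *\<^sub>2 F"
    unfolding *[symmetric] .
  then show "hodge2 s g (A (cnj2 (U j))) = - \<i> *\<^sub>2 A (cnj2 (U j))"
    by (simp add: F_def)
qed

text \<open>The combination of \<open>A\<close> and its dual is the projection onto self-dual
  images: the two terms add up on \<open>U j\<close> and cancel on its conjugate.\<close>

lemma sd_weyl_action_frame: "bivector_action g w (U j) = A (U j)" "bivector_action g w (cnj2 (U j)) = 0"
  unfolding bivector_action_sd_weyl hodge2_action
  by (simp_all add: scale2_def vec_eq_iff)

lemma sd_weyl_antisymmetric: "w $ a $ b $ m $ n = - w $ a $ b $ n $ m"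
proof -
  have "(\<chi> r q. complexify4 W $ r $ q $ m $ n) = - (\<chi> r q. complexify4 W $ r $ q $ n $ m)"
    by (simp add: vec_eq_iff complexify4_def W_antisymmetric(2)[of _ _ m n])
  then show ?thesis
    by (simp add: sd_weyl_complexify4 hodge4_def hodge2_minus)
      (simp add: complexify4_def W_antisymmetric(2)[of a b m n] field_simps)
qed

text \<open>The minus sign compensates the norm -1 of the frame, so that \<open>c k\<close> is the
  eigenvalue on \<open>U k\<close>.\<close>

definition frame_tensor :: "(3 \<Rightarrow> complex) \<Rightarrow> tensor4" where
  "frame_tensor c = - (\<Sum>k\<in>UNIV. c k *\<^sub>4 (U k \<otimes> U k))"

lemma frame_tensor_nth: "frame_tensor c $ a $ b $ m $ n = - (\<Sum>k\<in>UNIV. c k * (U k $ a $ b * U k $ m $ n))"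
  by (simp add: frame_tensor_def scale4_def tensor_prod_def)

lemma frame_tensor_row: "frame_tensor c $ a $ b = - (\<Sum>k\<in>UNIV. (c k * U k $ a $ b) *\<^sub>2 U k)"
  by (simp add: vec_eq_iff frame_tensor_nth scale2_def mult_ac)

text \<open>Each \<open>w $ a $ b\<close> is a bivector in the last two indices. Its coefficients
  along the frame and the conjugate frame are components of the action of \<open>w\<close> on these,
  hence given by the eigenvalues and by 0.\<close>

lemma sd_weyl_canonical: "w = frame_tensor \<rho>"
proof -
  have "w $ a $ b = frame_tensor \<rho> $ a $ b" for a b
  proof -
    have 1: "bivector_metric g (U k) (w $ a $ b) = \<rho> k * U k $ a $ b" for k
      using eigen[of k] unfolding bivector_metric_commute[OF lorentzian, of "U k"] bivector_action_pairing[symmetric]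
      by (simp add: scale2_def)
    have 2: "bivector_metric g (cnj2 (U k)) (w $ a $ b) = 0" for k
      unfolding bivector_metric_commute[OF lorentzian, of "cnj2 (U k)"] bivector_action_pairing[symmetric] sd_weyl_action_frame
      by simp
    show ?thesis
      using bivector_expansion[of "w $ a $ b", OF sd_weyl_antisymmetric]
      unfolding 1 2 frame_tensor_row by simp
  qed
  then show ?thesis by (simp add: vec_eq_iff)
qed

text \<open>The eigenvalues are the diagonal entries, up to the factor -1/4, of the self-dual block
  of the Weyl form, which is traceless.\<close>

lemma sum_eigenvalues: "(\<Sum>k\<in>UNIV. \<rho> k) = 0"
proof -
  have "- \<rho> k = 1/4 * weyl_form g W (U k) (U k)" for k
    using weyl_form_action[OF lorentzian, of "U k" W "U k"]
    unfolding sd_weyl_action_frame(1)[symmetric] eigen bivector_metric_linear orthonormal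
    by simp
  then have "(\<Sum>k\<in>UNIV. - \<rho> k) = 1/4 * (\<Sum>k\<in>UNIV. weyl_form g W (U k) (U k))"
    by (simp only: sum_distrib_left)
  then show ?thesis by (simp add: weyl_form_trace[OF weyl] sum_negf)
qed

section \<open>Composition, trace and the invariants a and b\<close>

lemma bivector_action_frame_tensor:
  "bivector_action g (frame_tensor c) F = - (\<Sum>k\<in>UNIV. (c k * bivector_metric g (U k) F) *\<^sub>2 U k)"
proof -
  have "bivector_metric g (- H) F = - bivector_metric g H F" for H
    by (simp add: bivector_metric_pairing pairing_linear)
  then show ?thesis
    by (simp add: vec_eq_iff bivector_action_pairing frame_tensor_row bivector_metric_sum bivector_metric_linear)
      (simp add: scale2_def mult_ac)
qed

lemma bivector_comp_frame_tensor:
  "bivector_comp g (frame_tensor c) (frame_tensor d) = frame_tensor (\<lambda>k. c k * d k)"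
proof -
  have "bivector_comp g (frame_tensor c) (frame_tensor d) $ a $ b $ m $ n = frame_tensor (\<lambda>k. c k * d k) $ a $ b $ m $ n"
    for a b m n
  proof -
    have 1: "(\<chi> r q. frame_tensor d $ r $ q $ m $ n) = - (\<Sum>k\<in>UNIV. (d k * U k $ m $ n) *\<^sub>2 U k)"
      by (simp add: vec_eq_iff frame_tensor_nth scale2_def mult_ac)
    have 2: "bivector_metric g (U l) (- (\<Sum>k\<in>UNIV. (d k * U k $ m $ n) *\<^sub>2 U k)) = d l * U l $ m $ n" for l
      by (simp add: bivector_metric_linear bivector_metric_sum orthonormal sum_negf if_distrib cong: if_cong)
    show ?thesis
      unfolding bivector_comp_def vec_lambda_beta 1 bivector_action_frame_tensor 2
      by (simp add: frame_tensor_nth) (simp add: scale2_def mult_ac)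
  qed
  then show ?thesis by (simp add: vec_eq_iff)
qed

lemma bivector_trace_frame_tensor: "bivector_trace g (frame_tensor c) = (\<Sum>k\<in>UNIV. c k)"
proof -
  have r0: "raise2 g (- H) = - raise2 g H" for H
    using raise2_add[of g H "- H"] by (simp add: raise2_def[of g 0] eq_neg_iff_add_eq_0 add.commute vec_eq_iff)
  have rs: "raise2 g (\<Sum>k\<in>I. f k) = (\<Sum>k\<in>I. raise2 g (f k))" for I and f :: "3 \<Rightarrow> tensor2"
    by (induction I rule: infinite_finite_induct) (simp_all add: raise2_add raise2_def[of g 0] vec_eq_iff)
  have row: "(\<chi> m n. frame_tensor c $ a $ b $ m $ n) = - (\<Sum>k\<in>UNIV. (c k * U k $ a $ b) *\<^sub>2 U k)" for a b
    unfolding frame_tensor_row[symmetric] by (simp add: vec_eq_iff)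
  have "bivector_trace g (frame_tensor c) =
      - (\<Sum>a\<in>UNIV. \<Sum>b\<in>UNIV. \<Sum>k\<in>UNIV. 1/2 * c k * (U k $ a $ b * raise2 g (U k) $ a $ b))"
    unfolding bivector_trace_def row r0 rs raise2_scale
    by (simp add: scale2_def sum_negf sum_distrib_left mult_ac)
  also have "\<dots> = - (\<Sum>a\<in>UNIV. \<Sum>k\<in>UNIV. \<Sum>b\<in>UNIV. 1/2 * c k * (U k $ a $ b * raise2 g (U k) $ a $ b))"
    by (rule arg_cong[where f = uminus], rule sum.cong[OF refl], rule sum.swap)
  also have "\<dots> = - (\<Sum>k\<in>UNIV. \<Sum>a\<in>UNIV. \<Sum>b\<in>UNIV. 1/2 * c k * (U k $ a $ b * raise2 g (U k) $ a $ b))"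
    by (rule arg_cong[where f = uminus], rule sum.swap)
  also have "\<dots> = - (\<Sum>k\<in>UNIV. c k * bivector_metric g (U k) (U k))"
    by (simp add: bivector_metric_def sum_distrib_left mult_ac)
  also have "\<dots> = (\<Sum>k\<in>UNIV. c k)"
    by (simp add: orthonormal sum_negf)
  finally show ?thesis .
qed

lemma weyl_a_eq: "weyl_a s g W = (\<Sum>k\<in>UNIV. \<rho> k ^ 2)"
  by (simp add: weyl_a_def sd_weyl_canonical bivector_comp_frame_tensor bivector_trace_frame_tensor power2_eq_square)

lemma weyl_b_eq: "weyl_b s g W = (\<Sum>k\<in>UNIV. \<rho> k ^ 3)"
  by (simp add: weyl_b_def sd_weyl_canonical bivector_comp_frame_tensor bivector_trace_frame_tensor power3_eq_cube mult_ac)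

text \<open>Some frame coefficient of an eigenvector is nonzero, and comparing it before and after
  the action identifies the eigenvalue. This bounds the number of eigenvalues by the number of
  distinct \<open>\<rho> k\<close>.\<close>

lemma weyl_eigenvalues_subset: "weyl_eigenvalues s g W \<subseteq> range \<rho>"
proof
  fix r assume "r \<in> weyl_eigenvalues s g W"
  then obtain F where F: "self_dual s g F" "F \<noteq> 0" "bivector_action g w F = r *\<^sub>2 F"
    by (auto simp: weyl_eigenvalues_def scale2_def)
  have anti: "F $ a $ b = - F $ b $ a" for a b
    using F(1) unfolding self_dual_def by blast
  have "F = - (\<Sum>k\<in>UNIV. bivector_metric g (U k) F *\<^sub>2 U k)"
    using bivector_expansion[OF anti] by (simp add: anti_self_dual_orthogonal[OF F(1)])
  with F(2) obtain l where l: "bivector_metric g (U l) F \<noteq> 0"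
    by (metis (no_types, lifting) ctensor.scale_zero_left neg_0_equal_iff_equal sum.neutral)
  have "r * bivector_metric g (U l) F = bivector_metric g (U l) (bivector_action g w F)"
    by (simp add: F(3) bivector_metric_linear)
  also have "\<dots> = \<rho> l * bivector_metric g (U l) F"
    by (simp add: sd_weyl_canonical bivector_action_frame_tensor bivector_metric_linear bivector_metric_sum orthonormal
        sum_negf if_distrib cong: if_cong)
  finally have "r = \<rho> l" using l by simp
  then show "r \<in> range \<rho>" by simp
qed

end

section \<open>Tensors diagonal in the products of the frame\<close>

context sd_frame
begin

text \<open>The coefficients are left general, since the eigenspaces only depend on the level sets
  of \<open>\<mu>\<close>.\<close>

definition spectral :: "(3 \<Rightarrow> 3 \<Rightarrow> complex) \<Rightarrow> tensor4" where
  "spectral \<mu> = (\<Sum>i\<in>UNIV. \<Sum>j\<in>UNIV. \<mu> i j *\<^sub>4 (P i j \<otimes> P i j))"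

lemma tensor_action_spectral:
  "tensor_action g (spectral \<mu>) X = (\<Sum>i\<in>UNIV. \<Sum>j\<in>UNIV. (\<mu> i j * pairing g (P i j) X) *\<^sub>2 P i j)"
proof -
  have "tensor_action g (spectral \<mu>) X $ a $ b = (\<Sum>i\<in>UNIV. \<Sum>j\<in>UNIV. (\<mu> i j * pairing g (P i j) X) *\<^sub>2 P i j) $ a $ b" for a b
  proof -
    have "tensor_action g (spectral \<mu>) X $ a $ b = (\<Sum>m\<in>UNIV. \<Sum>n\<in>UNIV. \<Sum>i\<in>UNIV. \<Sum>j\<in>UNIV.
        \<mu> i j * (P i j $ m $ n * raise2 g X $ m $ n) * P i j $ a $ b)"
      by (simp add: tensor_action_def spectral_def scale4_def tensor_prod_def sum_distrib_left sum_distrib_right mult_ac)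
    also have "\<dots> = (\<Sum>i\<in>UNIV. \<Sum>j\<in>UNIV. \<Sum>m\<in>UNIV. \<Sum>n\<in>UNIV.
        \<mu> i j * (P i j $ m $ n * raise2 g X $ m $ n) * P i j $ a $ b)"
      by (rule sum_swap2)
    also have "\<dots> = (\<Sum>i\<in>UNIV. \<Sum>j\<in>UNIV. (\<mu> i j * pairing g (P i j) X) *\<^sub>2 P i j) $ a $ b"
      by (simp add: scale2_def pairing_def sum_distrib_left sum_distrib_right mult_ac)
    finally show ?thesis .
  qed
  then show ?thesis by (simp add: vec_eq_iff)
qed

lemma P_combination_pairing:
  "pairing g (P k l) (\<Sum>i\<in>UNIV. \<Sum>j\<in>UNIV. c i j *\<^sub>2 P i j) = c k l"
proof -
  have "c i j * (if k = i \<and> l = j then 1 else 0) = (if j = l then if i = k then c i j else 0 else 0)" for i j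
    by simp
  then show ?thesis
    by (simp add: pairing_linear P_orthonormal)
qed

lemma P_combination_traceless_symmetric:
  "(\<Sum>i\<in>UNIV. \<Sum>j\<in>UNIV. c i j *\<^sub>2 P i j) \<in> traceless_symmetric g"
  by (intro ctensor.subspace_sum[OF traceless_symmetric_subspace]
      ctensor.subspace_scale[OF traceless_symmetric_subspace] P_traceless_symmetric)

lemma traceless_symmetric_eqI:
  assumes "X \<in> traceless_symmetric g" "Y \<in> traceless_symmetric g"
    and "\<And>i j. pairing g (P i j) X = pairing g (P i j) Y"
  shows "X = Y"
proof -
  have "X - Y = 0"
    by (rule P_complete) (simp_all add: assms ctensor.subspace_diff[OF traceless_symmetric_subspace] pairing_linear)
  then show ?thesis by simp
qed

lemma P_expansion:
  assumes "X \<in> traceless_symmetric g"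
  shows "X = (\<Sum>i\<in>UNIV. \<Sum>j\<in>UNIV. pairing g (P i j) X *\<^sub>2 P i j)"
  by (rule traceless_symmetric_eqI) (simp_all add: assms P_combination_traceless_symmetric P_combination_pairing)

lemma pairing_tensor_action_spectral:
  "pairing g (P i j) (tensor_action g (spectral \<mu>) X) = \<mu> i j * pairing g (P i j) X"
  unfolding tensor_action_spectral P_combination_pairing ..

lemma tensor_action_spectral_traceless_symmetric: "tensor_action g (spectral \<mu>) X \<in> traceless_symmetric g"
  unfolding tensor_action_spectral by (rule P_combination_traceless_symmetric)

text \<open>Describes a span of products by vanishing coordinates, so that eigenvalue equations can
  be compared with it coordinate by coordinate.\<close>

lemma span_P:
  "ctensor.span (case_prod P ` K) = {X \<in> traceless_symmetric g. \<forall>i j. (i, j) \<notin> K \<longrightarrow> pairing g (P i j) X = 0}"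
  (is "_ = ?S")
proof
  have "ctensor.subspace ?S"
    using ctensor.subspace_0[OF traceless_symmetric_subspace] ctensor.subspace_add[OF traceless_symmetric_subspace]
      ctensor.subspace_scale[OF traceless_symmetric_subspace]
    by (intro ctensor.subspaceI) (simp_all add: pairing_linear)
  moreover have "case_prod P ` K \<subseteq> ?S"
    by (auto simp: P_traceless_symmetric P_orthonormal)
  ultimately show "ctensor.span (case_prod P ` K) \<subseteq> ?S"
    by (rule ctensor.span_minimal[rotated])
  show "?S \<subseteq> ctensor.span (case_prod P ` K)"
  proof
    fix X assume X: "X \<in> ?S"
    have "(\<Sum>i\<in>UNIV. \<Sum>j\<in>UNIV. pairing g (P i j) X *\<^sub>2 P i j) \<in> ctensor.span (case_prod P ` K)"
    proof (intro ctensor.span_sum)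
      fix i j
      show "pairing g (P i j) X *\<^sub>2 P i j \<in> ctensor.span (case_prod P ` K)"
      proof (cases "(i, j) \<in> K")
        case True
        then have "P i j \<in> case_prod P ` K" by force
        then show ?thesis by (intro ctensor.span_scale ctensor.span_base)
      next
        case False
        then show ?thesis using X by (simp add: ctensor.span_zero)
      qed
    qed
    then show "X \<in> ctensor.span (case_prod P ` K)"
      using P_expansion[of X] X by simp
  qed
qed

lemma dim_span_P: "ctensor.dim (ctensor.span (case_prod P ` K)) = card K"
proof -
  have inj: "inj (case_prod P)"
  proof (rule injI, clarify)
    fix i j k l assume "P i j = P k l"
    then have "pairing g (P i j) (P k l) = 1"
      using P_orthonormal[of k l k l] by simp
    then show "i = k \<and> j = l"
      by (simp add: P_orthonormal split: if_splits)
  qed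
  have "ctensor.independent (case_prod P ` K)"
    unfolding ctensor.dependent_def
  proof clarsimp
    \<comment> \<open>A combination of the other products pairs to 0 with \<open>P i j\<close>,
      whereas \<open>P i j\<close> pairs to 1 with itself.\<close>
    fix i j assume "(i, j) \<in> K" and "P i j \<in> ctensor.span (case_prod P ` K - {P i j})"
    moreover have "case_prod P ` K - {P i j} = case_prod P ` (K - {(i, j)})"
      using inj by (simp add: image_set_diff)
    ultimately have "pairing g (P i j) (P i j) = 0"
      using span_P[of "K - {(i, j)}"] by auto
    then show False by (simp add: P_orthonormal)
  qed
  moreover have "card (case_prod P ` K) = card K"
    using inj by (meson card_image inj_on_subset subset_UNIV)
  ultimately show ?thesis
    by (metis ctensor.dim_span_eq_card_independent)
qed

text \<open>In the coordinates \<open>pairing g (P i j) X\<close>, the operator minus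
  \<open>r\<close> multiplies by \<open>\<mu> i j - r\<close>. A power of this number vanishes only
  if the number does, so generalised eigenvectors are eigenvectors.\<close>

lemma spectral_eigenspaces:
  fixes \<mu> r
  defines "K \<equiv> {(i, j). \<mu> i j = r}"
  shows "eigenspace g (spectral \<mu>) r = ctensor.span (case_prod P ` K)"
    and "eigenvalue_multiplicity g (spectral \<mu>) r = card K"
proof -
  let ?L = "tensor_action g (spectral \<mu>)"
  let ?D = "\<lambda>X. ?L X - r *\<^sub>2 X"
  have scale: "r *\<^sub>2 X \<in> traceless_symmetric g" if "X \<in> traceless_symmetric g" for X
    using ctensor.subspace_scale[OF traceless_symmetric_subspace that] .
  have D: "(?D ^^ k) X \<in> traceless_symmetric g \<and>
      pairing g (P i j) ((?D ^^ k) X) = (\<mu> i j - r) ^ k * pairing g (P i j) X"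
    if "X \<in> traceless_symmetric g" for k X i j
    by (induction k)
      (simp_all add: that scale ctensor.subspace_diff[OF traceless_symmetric_subspace]
        tensor_action_spectral_traceless_symmetric pairing_linear pairing_tensor_action_spectral algebra_simps)
  have eig: "?L X = r *\<^sub>2 X" if X: "X \<in> ctensor.span (case_prod P ` K)" for X
  proof (rule traceless_symmetric_eqI)
    show "r *\<^sub>2 X \<in> traceless_symmetric g" using X scale by (simp add: span_P)
    show "pairing g (P i j) (?L X) = pairing g (P i j) (r *\<^sub>2 X)" for i j
      using X by (cases "\<mu> i j = r") (simp_all add: span_P K_def pairing_linear pairing_tensor_action_spectral)
  qed (rule tensor_action_spectral_traceless_symmetric)
  have gen: "X \<in> ctensor.span (case_prod P ` K)"
    if "X \<in> traceless_symmetric g" "(?D ^^ k) X = 0" for X k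
    using D[OF that(1), of k] that by (auto simp: span_P K_def pairing_zero)
  show "eigenspace g (spectral \<mu>) r = ctensor.span (case_prod P ` K)"
  proof (intro equalityI subsetI)
    fix X assume "X \<in> eigenspace g (spectral \<mu>) r"
    then show "X \<in> ctensor.span (case_prod P ` K)"
      using gen[of X 1] by (simp add: eigenspace_def)
  next
    fix X assume "X \<in> ctensor.span (case_prod P ` K)"
    then show "X \<in> eigenspace g (spectral \<mu>) r"
      using eig[of X] by (simp add: eigenspace_def span_P)
  qed
  have "{X \<in> traceless_symmetric g. \<exists>k. (?D ^^ k) X = 0} = ctensor.span (case_prod P ` K)"
  proof (intro equalityI subsetI)
    fix X assume X: "X \<in> ctensor.span (case_prod P ` K)"
    then have "(?D ^^ 1) X = 0"
      using eig[of X] by simp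
    then show "X \<in> {X \<in> traceless_symmetric g. \<exists>k. (?D ^^ k) X = 0}"
      using X unfolding span_P by blast
  qed (use gen in blast)
  then show "eigenvalue_multiplicity g (spectral \<mu>) r = card K"
    by (simp only: eigenvalue_multiplicity_def dim_span_P)
qed

end

text \<open>The contraction joins second with second and fourth with fourth indices, so in the frame
  expansion the double sum over \<open>r\<close> and \<open>q\<close> factors into a component of
  \<open>P i j\<close> for each. The minus signs of the two Weyl expansions cancel, and so do those
  of the two products.\<close>

lemma (in sd_eigenframe) bel_robinson_spectral:
  "bel_robinson s g W = spectral (\<lambda>i j. \<rho> i * cnj (\<rho> j))"
proof -
  \<comment> \<open>\<open>u i\<close> is \<open>U i\<close> with its second index raised.\<close>
  define u where "u i a r = (\<Sum>c\<in>UNIV. ginv g $ r $ c * U i $ a $ c)" for i a r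
  have P: "P i j $ a $ m = - (\<Sum>r\<in>UNIV. u i a r * cnj (U j $ m $ r))" for i j a m
  proof -
    have "P i j $ a $ m = (\<Sum>r\<in>UNIV. u i a r * cnj (U j $ r $ m))"
      unfolding P_def tensor_dot_def u_def
      by (simp add: matrix_matrix_mult_def cnj2_def ginv_symmetric[OF lorentzian, of _ r for r] mult_ac)
    then show ?thesis
      unfolding antisymmetric[of j _ m] by (simp add: sum_negf)
  qed
  have raise: "raise2 g (\<chi> r' q'. w $ a $ r' $ b $ q') $ r $ q = - (\<Sum>i\<in>UNIV. \<rho> i * (u i a r * u i b q))" for a b r q
  proof -
    have "raise2 g (\<chi> r' q'. w $ a $ r' $ b $ q') $ r $ q = - (\<Sum>c\<in>UNIV. \<Sum>d\<in>UNIV. \<Sum>i\<in>UNIV.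
        \<rho> i * ((ginv g $ r $ c * U i $ a $ c) * (ginv g $ q $ d * U i $ b $ d)))"
      by (simp add: raise2_def sd_weyl_canonical frame_tensor_nth sum_negf sum_distrib_left mult_ac)
    also have "\<dots> = - (\<Sum>c\<in>UNIV. \<Sum>i\<in>UNIV. \<Sum>d\<in>UNIV.
        \<rho> i * ((ginv g $ r $ c * U i $ a $ c) * (ginv g $ q $ d * U i $ b $ d)))"
      by (rule arg_cong[where f = uminus], rule sum.cong[OF refl], rule sum.swap)
    also have "\<dots> = - (\<Sum>i\<in>UNIV. \<Sum>c\<in>UNIV. \<Sum>d\<in>UNIV.
        \<rho> i * ((ginv g $ r $ c * U i $ a $ c) * (ginv g $ q $ d * U i $ b $ d)))"
      by (rule arg_cong[where f = uminus], rule sum.swap)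
    also have "\<dots> = - (\<Sum>i\<in>UNIV. \<rho> i * (u i a r * u i b q))"
      unfolding u_def sum_product unfolding sum_distrib_left ..
    finally show ?thesis .
  qed
  have "bel_robinson s g W $ a $ m $ b $ n = spectral (\<lambda>i j. \<rho> i * cnj (\<rho> j)) $ a $ m $ b $ n" for a m b n
  proof -
    have "bel_robinson s g W $ a $ m $ b $ n = (\<Sum>r\<in>UNIV. \<Sum>q\<in>UNIV.
        (\<Sum>i\<in>UNIV. \<rho> i * (u i a r * u i b q)) * (\<Sum>j\<in>UNIV. cnj (\<rho> j) * (cnj (U j $ m $ r) * cnj (U j $ n $ q))))"
      unfolding bel_robinson_def Let_def vec_lambda_beta raise
      by (simp add: sd_weyl_canonical frame_tensor_nth)
    also have "\<dots> = (\<Sum>r\<in>UNIV. \<Sum>q\<in>UNIV. \<Sum>i\<in>UNIV. \<Sum>j\<in>UNIV. \<rho> i * cnj (\<rho> j) *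
        ((u i a r * cnj (U j $ m $ r)) * (u i b q * cnj (U j $ n $ q))))"
      by (simp add: sum_product mult_ac)
    also have "\<dots> = (\<Sum>i\<in>UNIV. \<Sum>j\<in>UNIV. \<Sum>r\<in>UNIV. \<Sum>q\<in>UNIV. \<rho> i * cnj (\<rho> j) *
        ((u i a r * cnj (U j $ m $ r)) * (u i b q * cnj (U j $ n $ q))))"
      by (rule sum_swap2)
    also have "\<dots> = (\<Sum>i\<in>UNIV. \<Sum>j\<in>UNIV. \<rho> i * cnj (\<rho> j) *
        ((\<Sum>r\<in>UNIV. u i a r * cnj (U j $ m $ r)) * (\<Sum>q\<in>UNIV. u i b q * cnj (U j $ n $ q))))"
      unfolding sum_product unfolding sum_distrib_left ..
    also have "\<dots> = spectral (\<lambda>i j. \<rho> i * cnj (\<rho> j)) $ a $ m $ b $ n"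
      by (simp add: spectral_def scale4_def tensor_prod_def P)
    finally show ?thesis .
  qed
  then show ?thesis by (simp add: vec_eq_iff)
qed

text \<open>All six numbers are determined by the real \<open>t\<close> and by
  \<open>\<tau>3\<close>: \<open>\<tau> = - cnj \<tau>3 - t\<close> and
  \<open>t3 = 2 * t + \<tau>3 + cnj \<tau>3\<close>. Two of them can agree only if
  \<open>Im \<tau>3 = 0\<close> or \<open>2 * Re \<tau>3 = - Re t\<close>.\<close>

lemma type_IM_minus_distinct_products:
  fixes x y z :: complex
  assumes sum: "x + y + z = 0" and cube: "x ^ 3 + y ^ 3 + z ^ 3 \<noteq> 0"
    and square: "x\<^sup>2 + y\<^sup>2 + z\<^sup>2 \<noteq> 0" and "x \<noteq> y" and mod: "cmod x = cmod y"
  defines "t \<equiv> complex_of_real ((cmod x)\<^sup>2)" and "t3 \<equiv> complex_of_real ((cmod z)\<^sup>2)"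
    and "\<tau> \<equiv> y * cnj z" and "\<tau>3 \<equiv> x * cnj y"
  shows "\<tau> = z * cnj x" and "distinct [t, t3, \<tau>, cnj \<tau>, \<tau>3, cnj \<tau>3]"
proof -
  have z: "z = - x - y"
    using sum by (simp add: algebra_simps eq_neg_iff_add_eq_0)
  have txx: "x * cnj x = t" and tzz: "z * cnj z = t3"
    unfolding t_def t3_def complex_norm_square by (rule refl)+
  have tyy: "y * cnj y = t"
    unfolding t_def mod complex_norm_square by (rule refl)
  have \<tau>: "\<tau> = - cnj \<tau>3 - t"
    using tyy by (simp add: \<tau>_def \<tau>3_def z algebra_simps)
  show "\<tau> = z * cnj x"
    unfolding \<tau> using txx by (simp add: \<tau>3_def z algebra_simps)
  have t3: "t3 = 2 * t + \<tau>3 + cnj \<tau>3"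
    unfolding tzz[symmetric] using txx tyy by (simp add: \<tau>3_def z algebra_simps)
  have y0: "y \<noteq> 0"
    using \<open>x \<noteq> y\<close> mod by auto
  have x0: "x \<noteq> 0"
    using \<open>x \<noteq> y\<close> mod by auto
  have z0: "x \<noteq> - y"
    using cube by (auto simp: z)
  \<comment> \<open>Equality here means \<open>t3 = t\<close>: three numbers of equal modulus with
    sum 0 form an equilateral triangle, whose squares sum to 0. The factor
    \<open>cnj (x * y)\<close> expresses the sum of squares through \<open>t\<close> and
    \<open>\<tau>3\<close>.\<close>
  have sq: "2 * Re \<tau>3 \<noteq> - Re t"
  proof
    assume "2 * Re \<tau>3 = - Re t"
    then have "\<tau>3 + cnj \<tau>3 + t = 0"
      by (simp add: complex_eq_iff t_def)
    then have "2 * t * (t + \<tau>3 + cnj \<tau>3) = 0"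
      by (simp add: algebra_simps)
    also have "2 * t * (t + \<tau>3 + cnj \<tau>3) = (x\<^sup>2 + y\<^sup>2 + z\<^sup>2) * cnj (x * y)"
    proof -
      have "(x\<^sup>2 + y\<^sup>2 + z\<^sup>2) * cnj (x * y) =
          2 * ((x * cnj x) * (x * cnj y) + (y * cnj y) * (y * cnj x) + (x * cnj x) * (y * cnj y))"
        by (simp add: z power2_eq_square algebra_simps)
      then show ?thesis
        by (simp only: txx tyy) (simp add: \<tau>3_def algebra_simps)
    qed
    finally show False
      using square x0 y0 by simp
  qed
  \<comment> \<open>A real \<open>\<tau>3\<close> of modulus \<open>t\<close> is \<open>t\<close> or
    \<open>- t\<close>. Cancelling \<open>cnj y\<close> gives \<open>x = y\<close> or
    \<open>x = - y\<close>; in the latter case \<open>z = 0\<close> and the cubes cancel.\<close>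
  have im: "Im \<tau>3 \<noteq> 0"
  proof
    assume "Im \<tau>3 = 0"
    moreover have "\<tau>3 * cnj \<tau>3 = t * t"
      unfolding txx[symmetric] by (subst (2) txx) (simp add: \<tau>3_def mult_ac flip: tyy)
    ultimately have "\<tau>3 * \<tau>3 = t * t"
      by (simp add: complex_eq_iff)
    then have "\<tau>3 = t \<or> \<tau>3 = - t"
      by (simp add: square_eq_iff)
    then have "x * cnj y = y * cnj y \<or> x * cnj y = (- y) * cnj y"
      by (simp add: \<tau>3_def tyy)
    then have "x = y \<or> x = - y"
      unfolding mult_cancel_right using y0 by simp
    then show False using \<open>x \<noteq> y\<close> z0 by blast
  qed
  have "Im t = 0" by (simp add: t_def)
  then show "distinct [t, t3, \<tau>, cnj \<tau>, \<tau>3, cnj \<tau>3]"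
    using im sq by (auto simp: \<tau> t3 complex_eq_iff)
qed

theorem proposition7:
  fixes g :: "real^4^4" and s :: real and W :: "real^4^4^4^4"
    and \<rho> :: "3 \<Rightarrow> complex" and U :: "3 \<Rightarrow> tensor2" and P :: "3 \<Rightarrow> 3 \<Rightarrow> tensor2"
    and T :: tensor4 and t t\<^sub>3 :: real and \<tau> \<tau>\<^sub>3 :: complex
  assumes "lorentzian g" and "s = 1 \<or> s = -1"
    and "weyl_tensor g W" and "type_IM_minus s g W" and "weyl_M s g W \<noteq> -6"
    and "\<And>i. self_dual s g (U i)"
    and "\<And>i j. bivector_metric g (U i) (U j) = (if i = j then -1 else 0)"
    and "\<And>i. bivector_action g (sd_weyl s g W) (U i) = \<rho> i *\<^sub>2 U i"
    and "cmod (\<rho> 1) = cmod (\<rho> 2)"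
    and "t = (cmod (\<rho> 1))\<^sup>2" and "t\<^sub>3 = (cmod (\<rho> 3))\<^sup>2"
    and "\<tau> = \<rho> 2 * cnj (\<rho> 3)" and "\<tau>\<^sub>3 = \<rho> 1 * cnj (\<rho> 2)"
    and "\<And>i j. P i j = tensor_dot g (U i) (cnj2 (U j))"
    and "T = bel_robinson s g W"
  shows "sd_weyl s g W = - (\<Sum>i\<in>UNIV. \<rho> i *\<^sub>4 (U i \<otimes> U i))
    \<and> \<tau> = \<rho> 3 * cnj (\<rho> 1)
    \<and> T = t *\<^sub>4 (P 1 1 \<otimes> P 1 1 + P 2 2 \<otimes> P 2 2) + t\<^sub>3 *\<^sub>4 (P 3 3 \<otimes> P 3 3)
        + \<tau> *\<^sub>4 (P 2 3 \<otimes> P 2 3 + P 3 1 \<otimes> P 3 1)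
        + cnj \<tau> *\<^sub>4 (P 3 2 \<otimes> P 3 2 + P 1 3 \<otimes> P 1 3)
        + \<tau>\<^sub>3 *\<^sub>4 (P 1 2 \<otimes> P 1 2) + cnj \<tau>\<^sub>3 *\<^sub>4 (P 2 1 \<otimes> P 2 1)
    \<and> (\<forall>(r, A) \<in> {(complex_of_real t\<^sub>3, P 3 3), (\<tau>\<^sub>3, P 1 2), (cnj \<tau>\<^sub>3, P 2 1)}.
         eigenvalue_multiplicity g T r = 1 \<and> A \<noteq> 0 \<and> eigenspace g T r = ctensor.span {A})
    \<and> (\<forall>(r, A, B) \<in> {(complex_of_real t, P 1 1, P 2 2), (\<tau>, P 2 3, P 3 1), (cnj \<tau>, P 3 2, P 1 3)}.
         eigenvalue_multiplicity g T r = 2 \<and> eigenspace g T r = ctensor.span {A, B} \<and>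
         ctensor.dim (eigenspace g T r) = 2)"
proof -
  interpret F: sd_eigenframe g s U W \<rho>
    by unfold_locales (use assms in auto)
  have P: "F.P i j = P i j" for i j
    by (simp add: F.P_def assms)
  define \<mu> where "\<mu> = (\<lambda>i j. \<rho> i * cnj (\<rho> j))"
  have T: "T = F.spectral \<mu>"
    unfolding assms \<mu>_def by (rule F.bel_robinson_spectral)
  have sum: "\<rho> 1 + \<rho> 2 + \<rho> 3 = 0"
    using F.sum_eigenvalues by (simp add: sum_3)
  have cube: "\<rho> 1 ^ 3 + \<rho> 2 ^ 3 + \<rho> 3 ^ 3 \<noteq> 0"
    using assms(4) by (simp add: type_IM_minus_def F.weyl_b_eq sum_3)
  \<comment> \<open>If \<open>weyl_a\<close> were 0, then \<open>weyl_M\<close> would be -6.\<close>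
  have square: "(\<rho> 1)\<^sup>2 + (\<rho> 2)\<^sup>2 + (\<rho> 3)\<^sup>2 \<noteq> 0"
    using assms(5) by (auto simp: weyl_M_def F.weyl_a_eq sum_3)
  \<comment> \<open>Type I counts eigenvalues as a set; with \<open>\<rho> 1 = \<rho> 2\<close> the
    range of \<open>\<rho>\<close>, which contains them all, has at most two elements.\<close>
  have "\<rho> 1 \<noteq> \<rho> 2"
  proof
    assume "\<rho> 1 = \<rho> 2"
    then have "range \<rho> = {\<rho> 2, \<rho> 3}"
      by (auto simp: UNIV_3)
    then have "card (weyl_eigenvalues s g W) \<le> card {\<rho> 2, \<rho> 3}"
      using F.weyl_eigenvalues_subset by (metis card_mono finite.emptyI finite.insertI)
    also have "\<dots> \<le> 2"
      by (simp add: card_insert_if)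
    finally show False
      using assms(4) by (simp add: type_IM_minus_def type_I_def)
  qed
  note dist = type_IM_minus_distinct_products[OF sum cube square this assms(9),
      folded assms(10) assms(11) assms(12) assms(13)]
  have \<tau>': "\<tau> = \<rho> 3 * cnj (\<rho> 1)"
    by (rule dist(1))
  have d: "distinct [complex_of_real t, complex_of_real t\<^sub>3, \<tau>, cnj \<tau>, \<tau>\<^sub>3, cnj \<tau>\<^sub>3]"
    by (rule dist(2))
  have \<mu>1: "\<mu> 1 1 = t" "\<mu> 3 3 = t\<^sub>3"
    unfolding assms(10,11) complex_norm_square \<mu>_def by (rule refl)+
  have \<mu>2: "\<mu> 2 2 = t"
    unfolding assms(10) assms(9) complex_norm_square \<mu>_def by (rule refl)
  have \<mu>3: "\<mu> 2 3 = \<tau>" "\<mu> 1 2 = \<tau>\<^sub>3" "\<mu> 3 2 = cnj \<tau>" "\<mu> 2 1 = cnj \<tau>\<^sub>3"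
    by (simp_all add: \<mu>_def assms(12,13) mult.commute)
  have \<mu>4: "\<mu> 3 1 = \<tau>" "\<mu> 1 3 = cnj \<tau>"
    by (simp_all add: \<mu>_def \<tau>' mult.commute)
  note \<mu> = \<mu>1 \<mu>2 \<mu>3 \<mu>4
  \<comment> \<open>The reversed list supplies every inequality in the opposite orientation, so that
    each of the nine comparisons in \<open>K\<close> simplifies whichever side a value stands
    on.\<close>
  have d': "distinct (rev [complex_of_real t, complex_of_real t\<^sub>3, \<tau>, cnj \<tau>, \<tau>\<^sub>3, cnj \<tau>\<^sub>3])"
    using d by (simp only: distinct_rev)
  have K: "{(i, j). \<mu> i j = complex_of_real t\<^sub>3} = {(3, 3)}" "{(i, j). \<mu> i j = \<tau>\<^sub>3} = {(1, 2)}"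
    "{(i, j). \<mu> i j = cnj \<tau>\<^sub>3} = {(2, 1)}" "{(i, j). \<mu> i j = complex_of_real t} = {(1, 1), (2, 2)}"
    "{(i, j). \<mu> i j = \<tau>} = {(2, 3), (3, 1)}" "{(i, j). \<mu> i j = cnj \<tau>} = {(3, 2), (1, 3)}"
    unfolding set_eq_iff split_paired_All forall_3 using d d' by (simp_all add: \<mu>)
  have nz: "P i j \<noteq> 0" for i j
    using F.P_orthonormal[of i j i j] by (auto simp: P pairing_zero)
  note S = F.spectral_eigenspaces[of \<mu>, folded T]
  \<comment> \<open>Geometric and algebraic multiplicity are both the size of the level set of
    \<open>\<mu>\<close>.\<close>
  have dim: "ctensor.dim (eigenspace g T r) = eigenvalue_multiplicity g T r" for r
    unfolding S F.dim_span_P ..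
  have "T = t *\<^sub>4 (P 1 1 \<otimes> P 1 1 + P 2 2 \<otimes> P 2 2) + t\<^sub>3 *\<^sub>4 (P 3 3 \<otimes> P 3 3)
        + \<tau> *\<^sub>4 (P 2 3 \<otimes> P 2 3 + P 3 1 \<otimes> P 3 1)
        + cnj \<tau> *\<^sub>4 (P 3 2 \<otimes> P 3 2 + P 1 3 \<otimes> P 1 3)
        + \<tau>\<^sub>3 *\<^sub>4 (P 1 2 \<otimes> P 1 2) + cnj \<tau>\<^sub>3 *\<^sub>4 (P 2 1 \<otimes> P 2 1)"
    unfolding T F.spectral_def P sum_3 \<mu>
    by (simp add: vec_eq_iff scale4_def algebra_simps)
  moreover have "\<forall>(r, A) \<in> {(complex_of_real t\<^sub>3, P 3 3), (\<tau>\<^sub>3, P 1 2), (cnj \<tau>\<^sub>3, P 2 1)}.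
         eigenvalue_multiplicity g T r = 1 \<and> A \<noteq> 0 \<and> eigenspace g T r = ctensor.span {A}"
    by (simp add: S K P nz)
  moreover have "\<forall>(r, A, B) \<in> {(complex_of_real t, P 1 1, P 2 2), (\<tau>, P 2 3, P 3 1), (cnj \<tau>, P 3 2, P 1 3)}.
         eigenvalue_multiplicity g T r = 2 \<and> eigenspace g T r = ctensor.span {A, B} \<and>
         ctensor.dim (eigenspace g T r) = 2"
    unfolding dim by (simp add: S K P)
  ultimately show ?thesis
    using F.sd_weyl_canonical \<tau>' unfolding F.frame_tensor_def by blast
qed

end
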